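(* Let $d\ge 2$, $Q\ge 1$, $\rho\in(0,1)$, $C = 12 + 4\log_d(Q/\rho)$, and let $N$ be an integer with $2\le N\le d/2$ and $\log(N)\, N \sqrt{C\log(d)/d}\le \frac14$. Let $f$ be the shielded Nemirovski function (see context) built with these parameters $N$, $\kappa=\sqrt{C\log(d)/d}$, $\gamma = 2\delta\kappa$, and with $\delta,\alpha$ as specified in the context. Fix any randomized algorithm which runs for at most $N$ rounds, and in each round submits (adaptively, based on all previous answers and its internal randomness) at most $Q$ query points in the closed unit Euclidean ball, receiving for each query point $x$ the value $f(x)$ and a (sub)gradient $\nabla f(x)$. Then, with probability at least $1-\rho$ (over the random choice of $v_1,\dots,v_N$ and the algorithm's randomness), every queried point $x$ satisfies $f(x)-f^*\ge \frac{1}{4\sqrt N}$, where $f^*=\min_{\|x\|\le 1} f(x)$.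
   Context: Let $v_1,\dots,v_N$ be a uniformly random (Haar-distributed) orthonormal family in $\mathbb{R}^d$ and $x^*=-\frac{1}{\sqrt N}\sum_{i=1}^N v_i$. Let $\kappa>0$, $\gamma\ge 0$, $\delta\in(0,1)$, $\alpha>0$. Nemirovski function: $\mathcal N(x)=\max_{i\in[N]}\{v_i\cdot x - i\gamma\}$. Correlation cones: $C_i=\{x\ne 0: |v_i\cdot x|/\|x\|\ge \kappa\}$. Let $h(x)=2\|x\|^{1+\alpha}$, $\Omega=\{x\in\mathbb{R}^d: \|x\|\in[\delta,1],\ x\notin C_i \text{ for all } i\in[N]\}$, and wall function $\mathcal W(x)=\sup_{y\in\Omega}\{h(y)+\nabla h(y)\cdot(x-y)\}$. Shielded Nemirovski function: $f(x)=\max\{\mathcal N(x),\mathcal W(x)\}$. In this theorem, $\kappa=\sqrt{C\log(d)/d}$, $\delta\in(0,1)$ is determined by $\frac{\delta}{\log_2(1/\delta)} = 4\sqrt{\frac{C N\log d}{d}}+\frac{1}{\sqrt N}$, $\alpha = 1/\log_2(1/\delta)$, and $\gamma=2\delta\kappa$. Natural logarithms unless a base is indicated.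
   Formalization: The subgradient returned at x is assumed to depend only on f near x (a local oracle); with arbitrary subgradients at kinks the claim fails, as the choice could reveal all the v_i. The algorithm and the oracle are assumed measurable. *)

theory Defs
  imports "HOL-Probability.Probability"
begin

definition orthonormal_frame :: "nat \<Rightarrow> (nat \<Rightarrow> real^'d) \<Rightarrow> bool" where
  "orthonormal_frame N v \<longleftrightarrow>
     (\<forall>i\<in>{1..N}. \<forall>j\<in>{1..N}. v i \<bullet> v j = (if i = j then 1 else 0))"

definition haar_frames :: "nat \<Rightarrow> (nat \<Rightarrow> real^'d) measure \<Rightarrow> bool" where
  "haar_frames N V \<longleftrightarrow>
     prob_space V \<and>
     sets V = sets (PiM {1..N} (\<lambda>_. borel)) \<and>
     (AE v in V. orthonormal_frame N v) \<and>
     (\<forall>T. orthogonal_transformation T \<longrightarrow>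
          distr V V (\<lambda>v. \<lambda>i\<in>{1..N}. T (v i)) = V)"

definition nemirovski :: "real \<Rightarrow> nat \<Rightarrow> (nat \<Rightarrow> real^'d) \<Rightarrow> real^'d \<Rightarrow> real" where
  "nemirovski \<gamma> N v x = Max ((\<lambda>i. v i \<bullet> x - real i * \<gamma>) ` {1..N})"

definition corr_cone :: "real \<Rightarrow> real^'d \<Rightarrow> (real^'d) set" where
  "corr_cone \<kappa> u = {x. x \<noteq> 0 \<and> \<bar>u \<bullet> x\<bar> / norm x \<ge> \<kappa>}"

definition shield_dom :: "real \<Rightarrow> real \<Rightarrow> nat \<Rightarrow> (nat \<Rightarrow> real^'d) \<Rightarrow> (real^'d) set" where
  "shield_dom \<kappa> \<delta> N v =
     {x. \<delta> \<le> norm x \<and> norm x \<le> 1 \<and> (\<forall>i\<in>{1..N}. x \<notin> corr_cone \<kappa> (v i))}"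

text \<open>\<open>h(x) = 2\<parallel>x\<parallel>^(1+\<alpha>)\<close> and its gradient \<open>\<nabla>h(y) = 2(1+\<alpha>)\<parallel>y\<parallel>^(\<alpha>-1) y\<close>
  (used only for \<open>y \<noteq> 0\<close>, since \<open>\<Omega>\<close> avoids a neighbourhood of 0).\<close>
definition hfun :: "real \<Rightarrow> real^'d \<Rightarrow> real" where
  "hfun \<alpha> x = 2 * norm x powr (1 + \<alpha>)"

definition hgrad :: "real \<Rightarrow> real^'d \<Rightarrow> real^'d" where
  "hgrad \<alpha> y = (2 * (1 + \<alpha>) * norm y powr (\<alpha> - 1)) *\<^sub>R y"

definition wall :: "real \<Rightarrow> real \<Rightarrow> real \<Rightarrow> nat \<Rightarrow> (nat \<Rightarrow> real^'d) \<Rightarrow> real^'d \<Rightarrow> real" where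
  "wall \<kappa> \<delta> \<alpha> N v x =
     (SUP y\<in>shield_dom \<kappa> \<delta> N v. hfun \<alpha> y + hgrad \<alpha> y \<bullet> (x - y))"

definition shielded_nemirovski ::
  "real \<Rightarrow> real \<Rightarrow> real \<Rightarrow> real \<Rightarrow> nat \<Rightarrow> (nat \<Rightarrow> real^'d) \<Rightarrow> real^'d \<Rightarrow> real" where
  "shielded_nemirovski \<kappa> \<gamma> \<delta> \<alpha> N v x = max (nemirovski \<gamma> N v x) (wall \<kappa> \<delta> \<alpha> N v x)"

text \<open>Interaction of a (randomised, adaptive) parallel algorithm with a first-order oracle.
  The algorithm has internal randomness \<open>r\<close>.  A history is a table
  \<open>H j q = (f(x), g(x))\<close> of answers to query \<open>q\<close> of round \<open>j\<close> (entries not yet asked are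
  \<open>(0,0)\<close>).  In round \<open>k\<close> the algorithm submits \<open>cnt k r H\<close> query points
  \<open>qry k r H 0, ..., qry k r H (cnt k r H - 1)\<close>.  \<open>transcript ... r k\<close> is the history
  after rounds \<open>0..k-1\<close>.\<close>

type_synonym 'a history = "nat \<Rightarrow> nat \<Rightarrow> real \<times> 'a"

primrec transcript ::
  "(nat \<Rightarrow> 'r \<Rightarrow> 'a::zero history \<Rightarrow> nat) \<Rightarrow> (nat \<Rightarrow> 'r \<Rightarrow> 'a history \<Rightarrow> nat \<Rightarrow> 'a)
   \<Rightarrow> ('a \<Rightarrow> real) \<Rightarrow> ('a \<Rightarrow> 'a) \<Rightarrow> 'r \<Rightarrow> nat \<Rightarrow> 'a history" where
  "transcript cnt qry F G r 0 = (\<lambda>_ _. (0, 0))"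
| "transcript cnt qry F G r (Suc k) =
     (let H = transcript cnt qry F G r k
      in (\<lambda>j q. if j < k then H j q
                else if j = k \<and> q < cnt k r H then (F (qry k r H q), G (qry k r H q))
                else (0, 0)))"

end

theory Submission
  imports Defs
begin

text \<open>
  A query \<open>x\<close> of round \<open>k\<close> (counted from 0) is uncorrelated if its component orthogonal to
  \<open>v\<^sub>1, \<dots>, v\<^sub>k\<close> vanishes or lies in none of the cones around \<open>v\<^sub>k\<^sub>+\<^sub>1, \<dots>, v\<^sub>N\<close>.  Near such a point the
  shielded function only involves \<open>v\<^sub>1, \<dots>, v\<^sub>k\<^sub>+\<^sub>1\<close>: if the orthogonal component is short, then
  \<open>\<gamma> = 2\<delta>\<kappa>\<close> makes the term of \<open>v\<^sub>k\<^sub>+\<^sub>1\<close> dominate the later ones in the maximum; if it is long, the wall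
  dominates; and the wall itself does not notice the later cones.  So as long as all
  queries are uncorrelated, the queries of round \<open>k\<close> are a function of \<open>v\<^sub>1, \<dots>, v\<^sub>k\<close> and the
  internal randomness, and all queried values exceed the minimum by \<open>1 / (4 \<surd>N)\<close>.

  Given \<open>v\<^sub>1, \<dots>, v\<^sub>k\<close>, the vector \<open>v\<^sub>i\<close> with \<open>i > k\<close> is uniform on a sphere of dimension
  \<open>d - k - 1\<close>.  Instead of conditioning, the law of the frame is written as that of a random orthogonal
  map applied to a fixed orthonormal frame \<open>e\<close>.  As the law does not depend on \<open>e\<close>, one may
  average over frames that share \<open>e\<^sub>1, \<dots>, e\<^sub>k\<close> and have the \<open>i\<close>-th vector
  \<open>(d - k)\<^sup>-\<^sup>1\<^sup>/\<^sup>2 \<Sum>\<^sub>j\<^sub>>\<^sub>k \<plusminus>b\<^sub>j\<close> with random signs, where \<open>b\<close> is a fixed orthonormal basis with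
  \<open>b\<^sub>j = e\<^sub>j\<close> for \<open>j \<le> k\<close>; the subgaussian tail of sign sums bounds the
  probability of a correlated query, and a union bound finishes the proof.
\<close>

section \<open>Geometry of the shielded function\<close>

text \<open>For an orthonormal \<open>v\<close> this is the projection of \<open>x\<close> onto the
  orthogonal complement of \<open>v 1\<close>, ..., \<open>v k\<close>. The explicit sum makes
  continuity, measurability and dependence on these vectors alone immediate.\<close>

definition frame_resid :: "nat \<Rightarrow> (nat \<Rightarrow> real^'d) \<Rightarrow> real^'d \<Rightarrow> real^'d" where
  "frame_resid k v x = x - (\<Sum>j\<in>{1..k}. (v j \<bullet> x) *\<^sub>R v j)"

text \<open>The inequality is stated for \<open>x\<close> itself, because for an orthonormal frame
  \<open>v i\<close> with \<open>i > k\<close> has the same inner product with \<open>x\<close> and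
  with its residual. A zero residual needs its own case, since the strict inequality cannot hold
  there.\<close>

definition uncorrelated :: "real \<Rightarrow> nat \<Rightarrow> nat \<Rightarrow> (nat \<Rightarrow> real^'d) \<Rightarrow> real^'d \<Rightarrow> bool" where
  "uncorrelated \<kappa> N k v x \<longleftrightarrow>
     frame_resid k v x = 0 \<or> (\<forall>i\<in>{k<..N}. \<bar>v i \<bullet> x\<bar> < \<kappa> * norm (frame_resid k v x))"

section \<open>Coordinates and residuals with respect to an orthonormal frame\<close>

lemma orthonormal_frameD:
  assumes "orthonormal_frame N v" "i \<in> {1..N}" "j \<in> {1..N}"
  shows "v i \<bullet> v j = (if i = j then 1 else 0)"
  using assms unfolding orthonormal_frame_def by blast

lemma orthonormal_frame_mono:
  "orthonormal_frame N v \<Longrightarrow> k \<le> N \<Longrightarrow> orthonormal_frame k v"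
  unfolding orthonormal_frame_def by auto

lemma orthonormal_frame_cong:
  "(\<And>i. i \<in> {1..N} \<Longrightarrow> v i = w i) \<Longrightarrow> orthonormal_frame N v \<longleftrightarrow> orthonormal_frame N w"
  unfolding orthonormal_frame_def by simp

lemma norm_orthonormal_frame:
  assumes "orthonormal_frame N v" "i \<in> {1..N}"
  shows "norm (v i) = 1"
  using orthonormal_frameD[OF assms assms(2)] by (simp add: norm_eq_sqrt_inner)

lemma inner_frame_sum:
  assumes "orthonormal_frame N v" "i \<in> {1..N}" "S \<subseteq> {1..N}"
  shows "v i \<bullet> (\<Sum>j\<in>S. c j *\<^sub>R v j) = (if i \<in> S then c i else 0)"
proof -
  have fin: "finite S" using assms(3) finite_subset by blast
  have "v i \<bullet> (\<Sum>j\<in>S. c j *\<^sub>R v j) = (\<Sum>j\<in>S. c j * (v i \<bullet> v j))"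
    by (simp add: inner_sum_right)
  also have "\<dots> = (\<Sum>j\<in>S. if i = j then c i else 0)"
    using assms(3) by (intro sum.cong) (auto simp: orthonormal_frameD[OF assms(1,2)] subset_iff)
  also have "\<dots> = (if i \<in> S then c i else 0)"
    using fin by simp
  finally show ?thesis .
qed

lemma frame_resid_cong:
  "(\<And>i. i \<in> {1..k} \<Longrightarrow> v i = w i) \<Longrightarrow> frame_resid k v x = frame_resid k w x"
  unfolding frame_resid_def by simp

lemma inner_frame_resid_low:
  assumes "orthonormal_frame k v" "i \<in> {1..k}"
  shows "v i \<bullet> frame_resid k v x = 0"
  unfolding frame_resid_def inner_diff_right
  using inner_frame_sum[OF assms order_refl, of "\<lambda>j. v j \<bullet> x"] assms(2) by simp

lemma inner_frame_resid_high:
  assumes "orthonormal_frame N v" "i \<in> {k<..N}"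
  shows "v i \<bullet> frame_resid k v x = v i \<bullet> x"
  unfolding frame_resid_def inner_diff_right
  using inner_frame_sum[OF assms(1), of i "{1..k}" "\<lambda>j. v j \<bullet> x"] assms(2) by auto

text \<open>The cross terms between span parts and residuals vanish; for \<open>x = y\<close> this
  becomes Pythagoras.\<close>

lemma inner_frame_decomp:
  assumes "orthonormal_frame k v"
  shows "x \<bullet> y = (\<Sum>j\<in>{1..k}. (v j \<bullet> x) * (v j \<bullet> y)) + frame_resid k v x \<bullet> frame_resid k v y"
proof -
  define p where "p = (\<Sum>j\<in>{1..k}. (v j \<bullet> x) *\<^sub>R v j)"
  have x: "x = p + frame_resid k v x" by (simp add: p_def frame_resid_def)
  have "p \<bullet> frame_resid k v y = 0"
    using inner_frame_resid_low[OF assms] by (simp add: p_def inner_sum_left)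
  moreover have "frame_resid k v x \<bullet> (\<Sum>j\<in>{1..k}. (v j \<bullet> y) *\<^sub>R v j) = 0"
    using inner_frame_resid_low[OF assms] by (simp add: inner_sum_right inner_commute)
  ultimately have "x \<bullet> y = p \<bullet> y + frame_resid k v x \<bullet> frame_resid k v y"
    by (subst (1) x) (simp add: frame_resid_def[of k v y] inner_add_left inner_diff_right)
  then show ?thesis by (simp add: p_def inner_sum_left)
qed

lemma norm_frame_decomp:
  assumes "orthonormal_frame k v"
  shows "(norm x)\<^sup>2 = (\<Sum>j\<in>{1..k}. (v j \<bullet> x)\<^sup>2) + (norm (frame_resid k v x))\<^sup>2"
  unfolding power2_norm_eq_inner using inner_frame_decomp[OF assms, of x x]
  by (simp add: power2_eq_square)

lemma norm_frame_resid_le: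
  assumes "orthonormal_frame k v"
  shows "norm (frame_resid k v x) \<le> norm x"
proof (rule power2_le_imp_le)
  show "(norm (frame_resid k v x))\<^sup>2 \<le> (norm x)\<^sup>2"
    unfolding norm_frame_decomp[OF assms, of x] by (simp add: sum_nonneg)
qed simp

text \<open>A zero residual reduces the inner product to \<open>k\<close> coordinates, and
  Cauchy-Schwarz against the constant vector gives the factor \<open>sqrt (real k)\<close>. It
  serves to show that points outside the cones are nearly orthogonal to the span of the
  frame.\<close>

lemma inner_le_of_frame_resid_0:
  assumes "orthonormal_frame k v" "frame_resid k v x = 0" "\<And>i. i \<in> {1..k} \<Longrightarrow> \<bar>v i \<bullet> y\<bar> \<le> c" "0 \<le> c"
  shows "y \<bullet> x \<le> c * sqrt (real k) * norm x"
proof -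
  have "y \<bullet> x = (\<Sum>j\<in>{1..k}. (v j \<bullet> y) * (v j \<bullet> x))"
    using inner_frame_decomp[OF assms(1), of y x] assms(2) by simp
  also have "\<dots> \<le> (\<Sum>j\<in>{1..k}. c * \<bar>v j \<bullet> x\<bar>)"
  proof (rule sum_mono)
    fix j assume j: "j \<in> {1..k}"
    have "(v j \<bullet> y) * (v j \<bullet> x) \<le> \<bar>v j \<bullet> y\<bar> * \<bar>v j \<bullet> x\<bar>"
      by (metis abs_ge_self abs_mult)
    also have "\<dots> \<le> c * \<bar>v j \<bullet> x\<bar>" using assms(3)[OF j] by (intro mult_right_mono) auto
    finally show "(v j \<bullet> y) * (v j \<bullet> x) \<le> c * \<bar>v j \<bullet> x\<bar>" .
  qed
  also have "\<dots> = c * (\<Sum>j\<in>{1..k}. \<bar>1::real\<bar> * \<bar>v j \<bullet> x\<bar>)" by (simp add: sum_distrib_left)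
  also have "\<dots> \<le> c * (L2_set (\<lambda>_. 1) {1..k} * L2_set (\<lambda>j. v j \<bullet> x) {1..k})"
    by (intro mult_left_mono L2_set_mult_ineq assms(4))
  also have "L2_set (\<lambda>j. v j \<bullet> x) {1..k} = norm x"
    unfolding L2_set_def using norm_frame_decomp[OF assms(1), of x] assms(2)
    by (intro real_sqrt_unique) auto
  finally show ?thesis by (simp add: L2_set_def)
qed

lemma continuous_on_frame_resid: "continuous_on S (frame_resid k v)"
  unfolding frame_resid_def by (intro continuous_intros)

section \<open>Tangents of \<open>hfun\<close>, and the wall as their supremum\<close>

definition wall_term :: "real \<Rightarrow> real^'d \<Rightarrow> real^'d \<Rightarrow> real" where
  "wall_term \<alpha> y x = hfun \<alpha> y + hgrad \<alpha> y \<bullet> (x - y)"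

text \<open>In this form the term depends on \<open>y\<close> only through its norm and
  \<open>y \<bullet> x\<close>, and for a fixed norm and \<open>\<alpha> \<ge> 0\<close> it grows
  with the inner product. The later comparisons of walls rest on this.\<close>

lemma wall_term_eq:
  assumes "y \<noteq> 0"
  shows "wall_term \<alpha> y x = 2 * norm y powr \<alpha> * ((1 + \<alpha>) * (y \<bullet> x) / norm y - \<alpha> * norm y)"
proof -
  have p: "norm y > 0" using assms by simp
  have 1: "norm y powr (1 + \<alpha>) = norm y powr \<alpha> * norm y"
    using p by (simp add: powr_add)
  have 2: "norm y powr (\<alpha> - 1) = norm y powr \<alpha> / norm y"
    using p by (simp add: powr_diff)
  show ?thesis
    unfolding wall_term_def hfun_def hgrad_def 1 2 using p
    by (simp add: inner_diff_right power2_norm_eq_inner[symmetric] field_simps power2_eq_square)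
qed

lemma shield_dom_iff:
  assumes "0 < \<delta>"
  shows "y \<in> shield_dom \<kappa> \<delta> k v \<longleftrightarrow>
    \<delta> \<le> norm y \<and> norm y \<le> 1 \<and> (\<forall>i\<in>{1..k}. \<bar>v i \<bullet> y\<bar> < \<kappa> * norm y)"
proof -
  have "(\<forall>i\<in>{1..k}. y \<notin> corr_cone \<kappa> (v i)) \<longleftrightarrow> (\<forall>i\<in>{1..k}. \<bar>v i \<bullet> y\<bar> < \<kappa> * norm y)" if "\<delta> \<le> norm y"
  proof -
    have "y \<noteq> 0" using that assms by auto
    then show ?thesis by (auto simp: corr_cone_def field_simps not_le)
  qed
  then show ?thesis unfolding shield_dom_def by blast
qed

text \<open>The factor \<open>norm y powr \<alpha>\<close> is at most 1 in the unit ball. The crude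
  bound is there to make the supremum in the wall one of a bounded set.\<close>

lemma wall_term_le:
  assumes "0 < \<delta>" "\<delta> \<le> norm y" "norm y \<le> 1" "0 \<le> \<alpha>"
  shows "wall_term \<alpha> y x \<le> 2 * (1 + \<alpha>) * norm x"
proof -
  have p: "norm y > 0" "y \<noteq> 0" using assms by auto
  have "(y \<bullet> x) / norm y \<le> norm x"
    using norm_cauchy_schwarz[of y x] p by (simp add: field_simps)
  then have "(1 + \<alpha>) * ((y \<bullet> x) / norm y) \<le> (1 + \<alpha>) * norm x"
    using assms by (intro mult_left_mono) auto
  then have "(1 + \<alpha>) * (y \<bullet> x) / norm y - \<alpha> * norm y \<le> (1 + \<alpha>) * norm x"
    using mult_nonneg_nonneg[OF assms(4) norm_ge_zero[of y]] by simp
  then have "wall_term \<alpha> y x \<le> 2 * norm y powr \<alpha> * ((1 + \<alpha>) * norm x)"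
    unfolding wall_term_eq[OF p(2)] by (intro mult_left_mono) auto
  also have "\<dots> \<le> 2 * 1 * ((1 + \<alpha>) * norm x)"
    using assms p by (intro mult_right_mono mult_left_mono powr_le_one_le) (auto simp: powr_le1)
  finally show ?thesis by (simp add: algebra_simps)
qed

text \<open>The gradient of \<open>hfun\<close> has norm at most \<open>2 * (1 + \<alpha>)\<close>
  at such \<open>y\<close>. This carries wall estimates from a query to its neighbourhood.\<close>

lemma wall_term_lipschitz:
  assumes "0 < \<delta>" "\<delta> \<le> norm y" "norm y \<le> 1" "0 \<le> \<alpha>"
  shows "wall_term \<alpha> y x' \<le> wall_term \<alpha> y x + 2 * (1 + \<alpha>) * norm (x' - x)"
proof -
  have p: "norm y > 0" "y \<noteq> 0" using assms by auto
  have "norm y powr (\<alpha> - 1) * norm y = norm y powr \<alpha>" 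
    using p by (simp add: powr_diff)
  then have "norm (hgrad \<alpha> y) = 2 * (1 + \<alpha>) * norm y powr \<alpha>"
    using assms by (simp add: hgrad_def)
  also have "\<dots> \<le> 2 * (1 + \<alpha>) * 1"
    using assms p by (intro mult_left_mono) (auto simp: powr_le1)
  finally have n: "norm (hgrad \<alpha> y) \<le> 2 * (1 + \<alpha>)" by simp
  have "wall_term \<alpha> y x' - wall_term \<alpha> y x = hgrad \<alpha> y \<bullet> (x' - x)"
    by (simp add: wall_term_def inner_diff_right)
  also have "\<dots> \<le> norm (hgrad \<alpha> y) * norm (x' - x)" by (rule norm_cauchy_schwarz)
  also have "\<dots> \<le> 2 * (1 + \<alpha>) * norm (x' - x)" using n by (intro mult_right_mono) auto
  finally show ?thesis by simp
qed

lemma wall_eq_SUP: "wall \<kappa> \<delta> \<alpha> k v x = (SUP y\<in>shield_dom \<kappa> \<delta> k v. wall_term \<alpha> y x)"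
  unfolding wall_def wall_term_def ..

lemma bdd_above_wall_term:
  assumes "0 < \<delta>" "0 \<le> \<alpha>"
  shows "bdd_above ((\<lambda>y. wall_term \<alpha> y x) ` shield_dom \<kappa> \<delta> k v)"
  by (intro bdd_aboveI2[of _ _ "2 * (1 + \<alpha>) * norm x"] wall_term_le[OF assms(1) _ _ assms(2)])
    (auto simp: shield_dom_def)

lemma wall_upper:
  assumes "0 < \<delta>" "0 \<le> \<alpha>" "y \<in> shield_dom \<kappa> \<delta> k v"
  shows "wall_term \<alpha> y x \<le> wall \<kappa> \<delta> \<alpha> k v x"
  unfolding wall_eq_SUP by (rule cSUP_upper[OF assms(3) bdd_above_wall_term[OF assms(1,2)]])

lemma wall_least:
  assumes "shield_dom \<kappa> \<delta> k v \<noteq> {}" "\<And>y. y \<in> shield_dom \<kappa> \<delta> k v \<Longrightarrow> wall_term \<alpha> y x \<le> c"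
  shows "wall \<kappa> \<delta> \<alpha> k v x \<le> c"
  unfolding wall_eq_SUP using assms by (intro cSUP_least) auto

lemma wall_cong:
  assumes "\<And>i. i \<in> {1..k} \<Longrightarrow> v i = w i"
  shows "wall \<kappa> \<delta> \<alpha> k v x = wall \<kappa> \<delta> \<alpha> k w x"
  using assms by (simp add: wall_def shield_dom_def)

lemma nemirovski_cong:
  assumes "\<And>i. i \<in> {1..k} \<Longrightarrow> v i = w i"
  shows "nemirovski \<gamma> k v x = nemirovski \<gamma> k w x"
  using assms unfolding nemirovski_def by (intro arg_cong[where f = Max] image_cong) auto

lemma nemirovski_ge:
  assumes "i \<in> {1..N}"
  shows "v i \<bullet> x - real i * \<gamma> \<le> nemirovski \<gamma> N v x"
  unfolding nemirovski_def using assms by (intro Max_ge) auto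

lemma nemirovski_le:
  assumes "1 \<le> N" "\<And>i. i \<in> {1..N} \<Longrightarrow> v i \<bullet> x - real i * \<gamma> \<le> c"
  shows "nemirovski \<gamma> N v x \<le> c"
  unfolding nemirovski_def using assms by (subst Max_le_iff) auto

lemma nemirovski_mono:
  assumes "1 \<le> k" "k \<le> N"
  shows "nemirovski \<gamma> k v x \<le> nemirovski \<gamma> N v x"
  using assms by (intro nemirovski_le nemirovski_ge) auto

lemma dim_span_frame_le: "dim (span (v ` {1..k})) \<le> k"
  using dim_le_card'[of "v ` {1..k}"] card_image_le[of "{1..k}" v] by simp

lemma exists_orthogonal_unit:
  fixes v :: "nat \<Rightarrow> real^'d"
  assumes "k < CARD('d)"
  obtains a where "norm a = 1" "\<And>i. i \<in> {1..k} \<Longrightarrow> v i \<bullet> a = 0"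
proof -
  have "dim (v ` {1..k}) < DIM(real^'d)"
    using dim_span_frame_le[of v k] assms by simp
  then obtain x where x: "x \<noteq> 0" "\<And>y. y \<in> span (v ` {1..k}) \<Longrightarrow> orthogonal x y"
    using orthogonal_to_subspace_exists by metis
  show ?thesis
  proof (rule that[of "x /\<^sub>R norm x"])
    show "v i \<bullet> (x /\<^sub>R norm x) = 0" if "i \<in> {1..k}" for i
      using x(2)[of "v i"] that by (simp add: span_base orthogonal_def inner_commute)
  qed (use x in simp)
qed

text \<open>A unit vector orthogonal to all \<open>v i\<close> lies in no cone. Nonemptiness matters
  because bounds on the single terms say nothing about \<open>Sup {}\<close>.\<close>

lemma shield_dom_nonempty:
  fixes v :: "nat \<Rightarrow> real^'d"
  assumes "k < CARD('d)" "0 < \<delta>" "\<delta> < 1" "0 < \<kappa>"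
  shows "shield_dom \<kappa> \<delta> k v \<noteq> {}"
proof -
  obtain a where "norm a = 1" "\<And>i. i \<in> {1..k} \<Longrightarrow> v i \<bullet> a = 0"
    using exists_orthogonal_unit[OF assms(1), of v] by blast
  then have "a \<in> shield_dom \<kappa> \<delta> k v"
    using assms by (simp add: shield_dom_iff)
  then show ?thesis by blast
qed

text \<open>Replacing the component of \<open>y\<close> orthogonal to \<open>v\<^sub>1, \<dots>, v\<^sub>k\<close> by a multiple of that of \<open>x\<close>
  keeps the norm, can only increase \<open>y \<bullet> x\<close>, and moves \<open>y\<close> out of the remaining cones.\<close>

lemma wall_uncorrelated:
  assumes on: "orthonormal_frame N v" and k: "k \<le> N"
    and par: "0 < \<delta>" "\<delta> < 1" "0 < \<kappa>" "0 \<le> \<alpha>"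
    and nz: "frame_resid k v x \<noteq> 0"
    and good: "\<And>i. i \<in> {k<..N} \<Longrightarrow> \<bar>v i \<bullet> x\<bar> < \<kappa> * norm (frame_resid k v x)"
  shows "wall \<kappa> \<delta> \<alpha> N v x = wall \<kappa> \<delta> \<alpha> k v x"
proof -
  define z where "z = frame_resid k v x"
  have onk: "orthonormal_frame k v" using orthonormal_frame_mono[OF on k] .
  have z: "norm z > 0" using nz by (simp add: z_def)
  have better: "\<exists>y'\<in>shield_dom \<kappa> \<delta> N v. wall_term \<alpha> y x \<le> wall_term \<alpha> y' x"
    if y: "y \<in> shield_dom \<kappa> \<delta> k v" for y
  proof -
    define t where "t = norm (frame_resid k v y) / norm z"
    define y' where "y' = (\<Sum>j\<in>{1..k}. (v j \<bullet> y) *\<^sub>R v j) + t *\<^sub>R z"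
    have t0: "0 \<le> t" by (simp add: t_def)
    have tz: "t * norm z = norm (frame_resid k v y)" using z by (simp add: t_def)
    have yb: "\<delta> \<le> norm y" "norm y \<le> 1" "\<And>i. i \<in> {1..k} \<Longrightarrow> \<bar>v i \<bullet> y\<bar> < \<kappa> * norm y"
      using y unfolding shield_dom_iff[OF par(1)] by auto
    then have ny: "norm y > 0" using par by linarith
    have low: "v i \<bullet> y' = v i \<bullet> y" if "i \<in> {1..k}" for i
      using inner_frame_sum[OF onk that order_refl, of "\<lambda>j. v j \<bullet> y"] that
        inner_frame_resid_low[OF onk that, of x]
      by (simp add: y'_def inner_add_right z_def)
    then have rs: "frame_resid k v y' = t *\<^sub>R z"
      by (simp add: frame_resid_def[of k v y']) (simp add: y'_def)
    have "(norm y')\<^sup>2 = (norm y)\<^sup>2"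
      unfolding norm_frame_decomp[OF onk, of y'] norm_frame_decomp[OF onk, of y] rs
      using low tz t0 by simp
    then have nn: "norm y' = norm y" by simp
    have high: "\<bar>v i \<bullet> y'\<bar> < \<kappa> * norm y" if i: "i \<in> {k<..N}" for i
    proof -
      have e: "v i \<bullet> y' = t * (v i \<bullet> x)"
        using inner_frame_resid_high[OF on i, of y'] inner_frame_resid_high[OF on i, of x] rs
        by (simp add: z_def)
      have "\<bar>v i \<bullet> y'\<bar> \<le> t * (\<kappa> * norm z)"
        unfolding e abs_mult using t0 good[OF i] by (intro mult_mono) (auto simp: z_def)
      also have "\<dots> = \<kappa> * norm (frame_resid k v y)" using tz by simp
      also have "\<dots> \<le> \<kappa> * norm y"
        using norm_frame_resid_le[OF onk] par by (intro mult_left_mono) auto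
      finally have le: "\<bar>v i \<bullet> y'\<bar> \<le> \<kappa> * norm y" .
      show ?thesis
      \<comment> \<open>Scaling the strict inequality \<open>good\<close> by \<open>t\<close> keeps
        it strict only for \<open>t > 0\<close>. For \<open>t = 0\<close> the inner product is 0 and
        \<open>norm y > 0\<close> gives strictness.\<close>
      proof (cases "t = 0")
        case True
        then show ?thesis using e par ny by simp
      next
        case False
        then have "t > 0" using t0 by simp
        then have "\<bar>v i \<bullet> y'\<bar> < t * (\<kappa> * norm z)"
          unfolding e abs_mult using good[OF i] by (simp add: z_def)
        also have "\<dots> = \<kappa> * norm (frame_resid k v y)" using tz by simp
        also have "\<dots> \<le> \<kappa> * norm y"
          using norm_frame_resid_le[OF onk] par by (intro mult_left_mono) auto
        finally show ?thesis .
      qed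
    qed
    have mem: "y' \<in> shield_dom \<kappa> \<delta> N v"
      unfolding shield_dom_iff[OF par(1)] nn
    proof (intro conjI ballI yb(1,2))
      fix i assume "i \<in> {1..N}"
      then consider "i \<in> {1..k}" | "i \<in> {k<..N}" by fastforce
      then show "\<bar>v i \<bullet> y'\<bar> < \<kappa> * norm y"
        using yb(3)[of i] low[of i] high[of i] by cases auto
    qed
    \<comment> \<open>Cauchy-Schwarz for the residuals becomes an equality for \<open>y'\<close>,
      whose residual is a nonnegative multiple of \<open>z\<close>.\<close>
    have "y \<bullet> x \<le> (\<Sum>j\<in>{1..k}. (v j \<bullet> y) * (v j \<bullet> x)) + norm (frame_resid k v y) * norm z"
      using inner_frame_decomp[OF onk, of y x] norm_cauchy_schwarz[of "frame_resid k v y" z]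
      by (simp add: z_def)
    also have "\<dots> = y' \<bullet> x"
      using inner_frame_decomp[OF onk, of y' x] rs low tz z
      by (simp add: z_def[symmetric] power2_norm_eq_inner[symmetric] power2_eq_square mult.assoc[symmetric])
    finally have inn: "y \<bullet> x \<le> y' \<bullet> x" .
    have "y \<noteq> 0" "y' \<noteq> 0" using ny nn by auto
    then have "wall_term \<alpha> y x \<le> wall_term \<alpha> y' x"
      unfolding wall_term_eq[OF \<open>y \<noteq> 0\<close>] wall_term_eq[OF \<open>y' \<noteq> 0\<close>] nn
      using inn par ny
      by (intro mult_left_mono diff_right_mono divide_right_mono) auto
    with mem show ?thesis by blast
  qed
  have "(1 / norm z) *\<^sub>R z \<in> shield_dom \<kappa> \<delta> k v"
    unfolding shield_dom_iff[OF par(1)]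
    using inner_frame_resid_low[OF onk, of _ x] z par by (auto simp: z_def)
  then have ne: "shield_dom \<kappa> \<delta> k v \<noteq> {}" by blast
  then have neN: "shield_dom \<kappa> \<delta> N v \<noteq> {}" using better by blast
  \<comment> \<open>The converse inequality is monotonicity: more vectors mean more cones and a
    smaller domain.\<close>
  have sub: "shield_dom \<kappa> \<delta> N v \<subseteq> shield_dom \<kappa> \<delta> k v"
    unfolding shield_dom_def using k by auto
  show ?thesis
  proof (rule antisym)
    show "wall \<kappa> \<delta> \<alpha> N v x \<le> wall \<kappa> \<delta> \<alpha> k v x"
      using sub by (intro wall_least[OF neN] wall_upper[OF par(1,4)]) auto
    show "wall \<kappa> \<delta> \<alpha> k v x \<le> wall \<kappa> \<delta> \<alpha> N v x"
    proof (rule wall_least[OF ne])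
      fix y assume "y \<in> shield_dom \<kappa> \<delta> k v"
      then obtain y' where "y' \<in> shield_dom \<kappa> \<delta> N v" "wall_term \<alpha> y x \<le> wall_term \<alpha> y' x"
        using better by blast
      then show "wall_term \<alpha> y x \<le> wall \<kappa> \<delta> \<alpha> N v x"
        using wall_upper[OF par(1,4), of y' \<kappa> N v x] by linarith
    qed
  qed
qed

text \<open>By the choice of \<open>\<alpha>\<close>, the factor
  \<open>2 * norm y powr \<alpha>\<close> of a wall term is at least 1 whenever
  \<open>\<delta> \<le> norm y\<close>.\<close>

lemma powr_ge_half:
  fixes t :: real
  assumes "\<delta> powr \<alpha> = 1 / 2" "0 < \<delta>" "\<delta> \<le> t" "0 \<le> \<alpha>"
  shows "1 / 2 \<le> t powr \<alpha>"
  using powr_mono2[OF assms(4) less_imp_le[OF assms(2)] assms(3)] assms(1) by simp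

text \<open>Take the tangent at a point \<open>y\<close> in the direction of the residual
  \<open>z\<close>. It is orthogonal to the frame, hence in no cone, and the bracket in
  \<open>wall_term_eq\<close> is \<open>(1 + \<alpha>) * norm z - \<alpha> * norm y\<close>, which
  is at least \<open>norm z\<close>. Capping the norm of \<open>y\<close> at 1 keeps it in the
  domain.\<close>

lemma wall_ge_resid:
  assumes on: "orthonormal_frame k v"
    and par: "0 < \<delta>" "\<delta> < 1" "0 < \<kappa>" "0 \<le> \<alpha>" "\<delta> powr \<alpha> = 1 / 2"
    and big: "\<delta> \<le> norm (frame_resid k v x)"
  shows "norm (frame_resid k v x) \<le> wall \<kappa> \<delta> \<alpha> k v x"
proof -
  define z where "z = frame_resid k v x"
  have z: "norm z > 0" "\<delta> \<le> norm z" using big par unfolding z_def by auto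
  define t where "t = min 1 (norm z)"
  have t: "0 < t" "\<delta> \<le> t" "t \<le> 1" "t \<le> norm z" using par z by (auto simp: t_def)
  define y where "y = (t / norm z) *\<^sub>R z"
  have ny: "norm y = t" using z t by (simp add: y_def)
  then have y0: "y \<noteq> 0" using t by auto
  have vy: "v i \<bullet> y = 0" if "i \<in> {1..k}" for i
    using inner_frame_resid_low[OF on that, of x] by (simp add: y_def z_def)
  have mem: "y \<in> shield_dom \<kappa> \<delta> k v"
    unfolding shield_dom_iff[OF par(1)] using ny t vy par by auto
  have zx: "z \<bullet> x = (norm z)\<^sup>2"
  proof -
    have "z \<bullet> x = (\<Sum>j\<in>{1..k}. (v j \<bullet> z) * (v j \<bullet> x)) + frame_resid k v z \<bullet> z"
      using inner_frame_decomp[OF on, of z x] by (simp add: z_def)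
    moreover have "v j \<bullet> z = 0" if "j \<in> {1..k}" for j
      using inner_frame_resid_low[OF on that, of x] by (simp add: z_def)
    moreover from this have "frame_resid k v z = z" by (simp add: frame_resid_def)
    ultimately show ?thesis by (simp add: power2_norm_eq_inner)
  qed
  have yx: "(y \<bullet> x) / norm y = norm z"
    unfolding ny using zx z t by (simp add: y_def power2_eq_square)
  have "norm z \<le> (1 + \<alpha>) * norm z - \<alpha> * t"
    using mult_left_mono[OF t(4) par(4)] by (simp add: algebra_simps)
  then have "1 * norm z \<le> 2 * t powr \<alpha> * ((1 + \<alpha>) * norm z - \<alpha> * t)"
    using powr_ge_half[OF par(5,1) t(2) par(4)] by (intro mult_mono) auto
  also have "\<dots> = wall_term \<alpha> y x"
    unfolding wall_term_eq[OF y0] using yx ny by (simp add: times_divide_eq_right[symmetric] del: times_divide_eq_right)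
  also have "\<dots> \<le> wall \<kappa> \<delta> \<alpha> k v x" by (rule wall_upper[OF par(1,4) mem])
  finally show ?thesis by (simp add: z_def)
qed

text \<open>Here \<open>x\<close> lies in the span of the frame, and a \<open>y\<close> outside the
  cones is almost orthogonal to it, so the term \<open>- \<alpha> * norm y\<close> outweighs the
  inner product.\<close>

lemma wall_term_le_span:
  assumes on: "orthonormal_frame k v" and kN: "k \<le> N"
    and par: "0 < \<delta>" "\<delta> < 1" "0 < \<kappa>" "0 \<le> \<alpha>" "\<delta> powr \<alpha> = 1 / 2"
    and pos: "0 \<le> \<alpha> * \<delta> - (1 + \<alpha>) * sqrt (real N) * \<kappa>"
    and z: "frame_resid k v x = 0" and x: "norm x \<le> 1"
    and y: "y \<in> shield_dom \<kappa> \<delta> k v"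
  shows "wall_term \<alpha> y x \<le> - (\<alpha> * \<delta> - (1 + \<alpha>) * sqrt (real N) * \<kappa>)"
proof -
  have yb: "\<delta> \<le> norm y" "norm y \<le> 1" "\<And>i. i \<in> {1..k} \<Longrightarrow> \<bar>v i \<bullet> y\<bar> < \<kappa> * norm y"
    using y unfolding shield_dom_iff[OF par(1)] by auto
  then have ny: "norm y > 0" "y \<noteq> 0" using par by auto
  have "y \<bullet> x \<le> \<kappa> * norm y * sqrt (real k) * norm x"
    using yb(3) par ny by (intro inner_le_of_frame_resid_0[OF on z]) (auto intro: less_imp_le)
  also have "\<dots> \<le> \<kappa> * norm y * sqrt (real N) * 1"
    using x kN par by (intro mult_mono) auto
  finally have "(y \<bullet> x) / norm y \<le> sqrt (real N) * \<kappa>"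
    using ny by (simp add: field_simps)
  then have "(1 + \<alpha>) * ((y \<bullet> x) / norm y) \<le> (1 + \<alpha>) * (sqrt (real N) * \<kappa>)"
    using par by (intro mult_left_mono) auto
  moreover have "\<alpha> * \<delta> \<le> \<alpha> * norm y" using yb par by (intro mult_left_mono) auto
  ultimately have 1: "(1 + \<alpha>) * (y \<bullet> x) / norm y - \<alpha> * norm y \<le> - (\<alpha> * \<delta> - (1 + \<alpha>) * sqrt (real N) * \<kappa>)"
    by (simp add: mult.assoc)
  have "wall_term \<alpha> y x \<le> 2 * norm y powr \<alpha> * - (\<alpha> * \<delta> - (1 + \<alpha>) * sqrt (real N) * \<kappa>)"
    unfolding wall_term_eq[OF ny(2)] using 1 by (intro mult_left_mono) auto
  \<comment> \<open>The bracket is nonpositive by \<open>pos\<close>, so a lower bound on the factor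
    gives an upper bound on the product.\<close>
  also have "\<dots> \<le> 1 * - (\<alpha> * \<delta> - (1 + \<alpha>) * sqrt (real N) * \<kappa>)"
    using powr_ge_half[OF par(5,1) yb(1) par(4)] pos by (intro mult_right_mono_neg) auto
  finally show ?thesis by simp
qed

lemma wall_le_span:
  fixes v :: "nat \<Rightarrow> real^'d"
  assumes on: "orthonormal_frame k v" and kN: "k \<le> N" "k < CARD('d)"
    and par: "0 < \<delta>" "\<delta> < 1" "0 < \<kappa>" "0 \<le> \<alpha>" "\<delta> powr \<alpha> = 1 / 2"
    and pos: "0 \<le> \<alpha> * \<delta> - (1 + \<alpha>) * sqrt (real N) * \<kappa>"
    and z: "frame_resid k v x = 0" and x: "norm x \<le> 1"
  shows "wall \<kappa> \<delta> \<alpha> k v x' \<le>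
    - (\<alpha> * \<delta> - (1 + \<alpha>) * sqrt (real N) * \<kappa>) + 2 * (1 + \<alpha>) * norm (x' - x)"
proof (rule wall_least[OF shield_dom_nonempty[OF kN(2) par(1-3)]])
  fix y assume y: "y \<in> shield_dom \<kappa> \<delta> k v"
  show "wall_term \<alpha> y x' \<le> - (\<alpha> * \<delta> - (1 + \<alpha>) * sqrt (real N) * \<kappa>) + 2 * (1 + \<alpha>) * norm (x' - x)"
    using wall_term_lipschitz[OF par(1) _ _ par(4), of y x' x] y
      wall_term_le_span[OF on kN(1) par pos z x y]
    by (simp add: shield_dom_def)
qed

text \<open>The case of a nonzero residual, stated at one point; it extends to a neighbourhood
  because \<open>nz\<close> and \<open>good\<close> are open conditions on \<open>x\<close>.\<close>

lemma shielded_nemirovski_eq_local: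
  assumes on: "orthonormal_frame N v" and k: "k < N"
    and par: "0 < \<delta>" "\<delta> < 1" "0 < \<kappa>" "\<kappa> \<le> 1" "0 \<le> \<alpha>" "\<delta> powr \<alpha> = 1 / 2"
    and nz: "frame_resid k v x \<noteq> 0"
    and good: "\<And>i. i \<in> {k<..N} \<Longrightarrow> \<bar>v i \<bullet> x\<bar> < \<kappa> * norm (frame_resid k v x)"
  shows "shielded_nemirovski \<kappa> (2 * \<delta> * \<kappa>) \<delta> \<alpha> N v x =
    max (nemirovski (2 * \<delta> * \<kappa>) (Suc k) v x) (wall \<kappa> \<delta> \<alpha> k v x)"
proof -
  let ?\<gamma> = "2 * \<delta> * \<kappa>" and ?z = "norm (frame_resid k v x)"
  have onk: "orthonormal_frame k v" using orthonormal_frame_mono[OF on] k by simp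
  have W: "wall \<kappa> \<delta> \<alpha> N v x = wall \<kappa> \<delta> \<alpha> k v x"
    using k by (intro wall_uncorrelated[OF on _ par(1-3,5) nz good]) auto
  have g0: "0 \<le> ?\<gamma>" using par by simp
  have "nemirovski ?\<gamma> N v x \<le> max (nemirovski ?\<gamma> (Suc k) v x) (wall \<kappa> \<delta> \<alpha> k v x)"
  proof (rule nemirovski_le)
    fix i assume i: "i \<in> {1..N}"
    show "v i \<bullet> x - real i * ?\<gamma> \<le> max (nemirovski ?\<gamma> (Suc k) v x) (wall \<kappa> \<delta> \<alpha> k v x)"
    proof (cases "i \<le> Suc k")
      case True
      then show ?thesis using nemirovski_ge[of i "Suc k" v x ?\<gamma>] i by simp
    next
      case False
      have bi: "\<bar>v i \<bullet> x\<bar> < \<kappa> * ?z" and bk: "\<bar>v (Suc k) \<bullet> x\<bar> < \<kappa> * ?z"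
        using good False i k by auto
      show ?thesis
      proof (cases "?z \<le> \<delta>")
        case True
        have "\<kappa> * ?z \<le> \<kappa> * \<delta>" using True par by (intro mult_left_mono) auto
        \<comment> \<open>Both correlations are at most \<open>\<kappa> * \<delta>\<close> in size
          and \<open>\<gamma>\<close> is exactly twice that, so one index step pays for their
          difference.\<close>
        then have 1: "v i \<bullet> x \<le> v (Suc k) \<bullet> x + ?\<gamma>" using bi bk by (simp add: algebra_simps)
        have "real (Suc k) + 1 \<le> real i" using False by simp
        then have "(real (Suc k) + 1) * ?\<gamma> \<le> real i * ?\<gamma>" using g0 by (intro mult_right_mono)
        then have "v i \<bullet> x - real i * ?\<gamma> \<le> v (Suc k) \<bullet> x - real (Suc k) * ?\<gamma>"
          using 1 by (simp add: algebra_simps)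
        then show ?thesis using nemirovski_ge[of "Suc k" "Suc k" v x ?\<gamma>] by simp
      next
        case False
        have "\<kappa> * ?z \<le> 1 * ?z" using par by (intro mult_right_mono) auto
        moreover have "0 \<le> real i * ?\<gamma>" using g0 by simp
        moreover have "?z \<le> wall \<kappa> \<delta> \<alpha> k v x"
          using False by (intro wall_ge_resid[OF onk par(1-3,5,6)]) simp
        ultimately have "v i \<bullet> x - real i * ?\<gamma> \<le> wall \<kappa> \<delta> \<alpha> k v x"
          using bi by linarith
        then show ?thesis by simp
      qed
    qed
  qed (use k in simp)
  moreover have "nemirovski ?\<gamma> (Suc k) v x \<le> nemirovski ?\<gamma> N v x"
    using k by (intro nemirovski_mono) auto
  ultimately show ?thesis
    unfolding shielded_nemirovski_def W by linarith
qed

text \<open>A whole ball is needed because the subgradient at a query is determined by the function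
  near it. At a zero residual the walls for \<open>N\<close> and for \<open>k\<close> are not
  compared with each other: both lie below the Nemirovski term nearby and drop out of the
  maximum.\<close>

lemma shielded_nemirovski_local:
  fixes v :: "nat \<Rightarrow> real^'d"
  assumes on: "orthonormal_frame N v" and k: "k < N" "N < CARD('d)"
    and par: "0 < \<delta>" "\<delta> < 1" "0 < \<kappa>" "\<kappa> \<le> 1" "0 \<le> \<alpha>" "\<delta> powr \<alpha> = 1 / 2"
    and pos: "real N * (2 * \<delta> * \<kappa>) < \<alpha> * \<delta> - (1 + \<alpha>) * sqrt (real N) * \<kappa>"
    and x: "norm x \<le> 1"
    and good: "uncorrelated \<kappa> N k v x"
  shows "\<exists>e>0. \<forall>x'\<in>ball x e. shielded_nemirovski \<kappa> (2 * \<delta> * \<kappa>) \<delta> \<alpha> N v x' =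
    max (nemirovski (2 * \<delta> * \<kappa>) (Suc k) v x') (wall \<kappa> \<delta> \<alpha> k v x')"
proof (cases "frame_resid k v x = 0")
  case False
  define U where "U = {x. frame_resid k v x \<noteq> 0} \<inter>
    (\<Inter>i\<in>{k<..N}. {x. \<bar>v i \<bullet> x\<bar> < \<kappa> * norm (frame_resid k v x)})"
  have "open U"
    unfolding U_def
    by (intro open_Int open_INT ballI open_Collect_neq open_Collect_less continuous_intros
        continuous_on_frame_resid) auto
  moreover have "x \<in> U" using False good by (auto simp: U_def uncorrelated_def)
  ultimately obtain e where e: "e > 0" "ball x e \<subseteq> U" using open_contains_ball by blast
  show ?thesis
  proof (intro exI[of _ e] conjI ballI e(1))
    fix x' assume "x' \<in> ball x e"
    then have "x' \<in> U" using e by blast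
    then show "shielded_nemirovski \<kappa> (2 * \<delta> * \<kappa>) \<delta> \<alpha> N v x' =
      max (nemirovski (2 * \<delta> * \<kappa>) (Suc k) v x') (wall \<kappa> \<delta> \<alpha> k v x')"
      using shielded_nemirovski_eq_local[OF on k(1) par, of x'] by (auto simp: U_def)
  qed
next
  case True
  let ?\<gamma> = "2 * \<delta> * \<kappa>" and ?D = "\<alpha> * \<delta> - (1 + \<alpha>) * sqrt (real N) * \<kappa>"
  have g0: "0 < ?\<gamma>" using par by simp
  have g1: "0 \<le> real N * ?\<gamma>" using g0 by simp
  have D0: "0 \<le> ?D" using pos g1 by linarith
  have onk: "orthonormal_frame k v" using orthonormal_frame_mono[OF on] k by simp
  \<comment> \<open>The first bound keeps \<open>v i \<bullet> x'\<close> and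
    \<open>v (Suc k) \<bullet> x'\<close> within \<open>\<gamma>\<close> of each other. The second
    comes from solving \<open>- ?D + 2 * (1 + \<alpha>) * r < - r - real N * ?\<gamma>\<close> for
    the distance \<open>r\<close>, with the wall bound on the left and the Nemirovski bound on the
    right.\<close>
  define e where "e = min (?\<gamma> / 2) ((?D - real N * ?\<gamma>) / (3 + 2 * \<alpha>))"
  have e0: "e > 0" using g0 pos par by (auto simp: e_def)
  \<comment> \<open>By Pythagoras, removing further components cannot lengthen the residual.\<close>
  have resN: "frame_resid N v x = 0"
    using norm_frame_decomp[OF on, of x] norm_frame_decomp[OF onk, of x] True
      sum_mono2[of "{1..N}" "{1..k}" "\<lambda>j. (v j \<bullet> x)\<^sup>2"] k by auto
  show ?thesis
  proof (intro exI[of _ e] conjI ballI e0)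
    fix x' assume "x' \<in> ball x e"
    then have d: "norm (x' - x) < e" by (simp add: dist_norm norm_minus_commute)
    have d1: "norm (x' - x) < ?\<gamma> / 2" using d by (simp add: e_def)
    have "norm (x' - x) < (?D - real N * ?\<gamma>) / (3 + 2 * \<alpha>)" using d unfolding e_def by linarith
    then have d2: "norm (x' - x) * (3 + 2 * \<alpha>) < ?D - real N * ?\<gamma>"
      using par by (simp add: pos_less_divide_eq)
    have vb: "\<bar>v i \<bullet> x'\<bar> \<le> norm (x' - x)" if "i \<in> {k<..N}" for i
    proof -
      have "v i \<bullet> x = 0" using inner_frame_resid_high[OF on that, of x] True by simp
      then have "v i \<bullet> x' = v i \<bullet> (x' - x)" by (simp add: inner_diff_right)
      also have "\<bar>\<dots>\<bar> \<le> norm (v i) * norm (x' - x)" by (rule Cauchy_Schwarz_ineq2)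
      also have "norm (v i) = 1" using that by (intro norm_orthonormal_frame[OF on]) auto
      finally show ?thesis by simp
    qed
    have low: "- norm (x' - x) - real N * ?\<gamma> \<le> nemirovski ?\<gamma> (Suc k) v x'"
    proof -
      have "real (Suc k) * ?\<gamma> \<le> real N * ?\<gamma>" using k g0 by (intro mult_right_mono) auto
      then show ?thesis
        using vb[of "Suc k"] k nemirovski_ge[of "Suc k" "Suc k" v x' ?\<gamma>] by auto
    qed
    have Wk: "wall \<kappa> \<delta> \<alpha> k v x' \<le> nemirovski ?\<gamma> (Suc k) v x'"
      using wall_le_span[OF onk _ _ par(1-3,5,6) D0 True x, of x'] k low d2
      by (simp add: algebra_simps)
    have WN: "wall \<kappa> \<delta> \<alpha> N v x' \<le> nemirovski ?\<gamma> (Suc k) v x'"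
      using wall_le_span[OF on order_refl _ par(1-3,5,6) D0 resN x, of x'] k low d2
      by (simp add: algebra_simps)
    have le: "nemirovski ?\<gamma> N v x' \<le> nemirovski ?\<gamma> (Suc k) v x'"
    proof (rule nemirovski_le)
      fix i assume i: "i \<in> {1..N}"
      show "v i \<bullet> x' - real i * ?\<gamma> \<le> nemirovski ?\<gamma> (Suc k) v x'"
      proof (cases "i \<le> Suc k")
        case True
        then show ?thesis using nemirovski_ge[of i "Suc k" v x' ?\<gamma>] i by simp
      next
        case False
        have 1: "v i \<bullet> x' \<le> v (Suc k) \<bullet> x' + ?\<gamma>"
          using vb[of i] vb[of "Suc k"] False i k d1 by auto
        have "real (Suc k) + 1 \<le> real i" using False by simp
        then have "(real (Suc k) + 1) * ?\<gamma> \<le> real i * ?\<gamma>" using g0 by (intro mult_right_mono) auto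
        then have "v i \<bullet> x' - real i * ?\<gamma> \<le> v (Suc k) \<bullet> x' - real (Suc k) * ?\<gamma>"
          using 1 by (simp add: algebra_simps)
        then show ?thesis using nemirovski_ge[of "Suc k" "Suc k" v x' ?\<gamma>] by simp
      qed
    qed (use k in simp)
    have "nemirovski ?\<gamma> (Suc k) v x' \<le> nemirovski ?\<gamma> N v x'"
      using k by (intro nemirovski_mono) auto
    then show "shielded_nemirovski \<kappa> ?\<gamma> \<delta> \<alpha> N v x' =
      max (nemirovski ?\<gamma> (Suc k) v x') (wall \<kappa> \<delta> \<alpha> k v x')"
      unfolding shielded_nemirovski_def using Wk WN le by linarith
  qed
qed

text \<open>One unseen direction suffices. If the residual has length at most
  \<open>\<delta>\<close>, then \<open>v (Suc k) \<bullet> x\<close> is at least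
  \<open>- \<kappa> * \<delta>\<close>; otherwise the wall, and with it the function, is
  positive.\<close>

lemma shielded_nemirovski_ge_uncorrelated:
  assumes on: "orthonormal_frame N v" and k: "k < N"
    and par: "0 < \<delta>" "\<delta> < 1" "0 < \<kappa>" "\<kappa> \<le> 1" "0 \<le> \<alpha>" "\<delta> powr \<alpha> = 1 / 2"
    and good: "uncorrelated \<kappa> N k v x"
  shows "- \<kappa> * \<delta> - real N * (2 * \<delta> * \<kappa>) \<le> shielded_nemirovski \<kappa> (2 * \<delta> * \<kappa>) \<delta> \<alpha> N v x"
proof -
  let ?\<gamma> = "2 * \<delta> * \<kappa>" and ?z = "norm (frame_resid k v x)"
  have g: "0 \<le> real N * ?\<gamma>" "0 \<le> \<kappa> * \<delta>" using par by auto
  have "real (Suc k) * ?\<gamma> \<le> real N * ?\<gamma>" using k par by (intro mult_right_mono) auto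
  then have nem: "v (Suc k) \<bullet> x - real N * ?\<gamma> \<le> shielded_nemirovski \<kappa> ?\<gamma> \<delta> \<alpha> N v x"
    using nemirovski_ge[of "Suc k" N v x ?\<gamma>] k unfolding shielded_nemirovski_def by auto
  have onk: "orthonormal_frame k v" using orthonormal_frame_mono[OF on] k by simp
  show ?thesis
  proof (cases "?z = 0")
    case True
    then have "v (Suc k) \<bullet> x = 0" using inner_frame_resid_high[OF on, of "Suc k" k x] k by simp
    then show ?thesis using nem g by simp
  next
    case False
    then have b: "\<And>i. i \<in> {k<..N} \<Longrightarrow> \<bar>v i \<bullet> x\<bar> < \<kappa> * ?z"
      using good by (auto simp: uncorrelated_def)
    show ?thesis
    proof (cases "?z \<le> \<delta>")
      case True
      have "\<kappa> * ?z \<le> \<kappa> * \<delta>" using True par by (intro mult_left_mono) auto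
      then show ?thesis using nem b[of "Suc k"] k by simp
    next
      case F: False
      have "?z \<le> wall \<kappa> \<delta> \<alpha> k v x"
        using F by (intro wall_ge_resid[OF onk par(1-3,5,6)]) simp
      also have "\<dots> = wall \<kappa> \<delta> \<alpha> N v x"
        using k False b by (intro wall_uncorrelated[OF on _ par(1-3,5), symmetric]) auto
      finally have "?z \<le> shielded_nemirovski \<kappa> ?\<gamma> \<delta> \<alpha> N v x"
        unfolding shielded_nemirovski_def by simp
      moreover have "0 \<le> ?z" by simp
      ultimately show ?thesis using g unfolding mult_minus_left by linarith
    qed
  qed
qed

text \<open>The test point is the negative normalised sum of the frame. All its coordinates are
  \<open>- 1 / sqrt (real N)\<close>, and its residual is zero, so \<open>wall_le_span\<close>
  controls the wall there.\<close>

lemma shielded_nemirovski_INF_le: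
  fixes v :: "nat \<Rightarrow> real^'d"
  assumes on: "orthonormal_frame N v" and k: "1 \<le> N" "N < CARD('d)"
    and par: "0 < \<delta>" "\<delta> < 1" "0 < \<kappa>" "0 \<le> \<alpha>" "\<delta> powr \<alpha> = 1 / 2" "0 \<le> \<gamma>"
    and pos: "0 \<le> \<alpha> * \<delta> - (1 + \<alpha>) * sqrt (real N) * \<kappa>"
  shows "(INF z\<in>cball 0 1. shielded_nemirovski \<kappa> \<gamma> \<delta> \<alpha> N v z) \<le>
    max (- 1 / sqrt (real N) - \<gamma>) (- (\<alpha> * \<delta> - (1 + \<alpha>) * sqrt (real N) * \<kappa>))"
proof -
  define c where "c = - 1 / sqrt (real N)"
  define x where "x = (\<Sum>j\<in>{1..N}. c *\<^sub>R v j)"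
  have vx: "v i \<bullet> x = c" if "i \<in> {1..N}" for i
    using inner_frame_sum[OF on that order_refl, of "\<lambda>_. c"] that by (simp add: x_def)
  have r: "frame_resid N v x = 0"
    unfolding frame_resid_def using vx by (simp add: x_def)
  have "(norm x)\<^sup>2 = 1"
    using norm_frame_decomp[OF on, of x] vx r k by (simp add: c_def power_divide)
  then have nx: "norm x = 1" by (simp add: power2_eq_1_iff) (metis norm_ge_zero neg_0_le_iff_le not_one_le_zero)
  have "nemirovski \<gamma> N v x \<le> c - \<gamma>"
  proof (rule nemirovski_le[OF k(1)])
    fix i assume i: "i \<in> {1..N}"
    have "1 * \<gamma> \<le> real i * \<gamma>" using i par by (intro mult_right_mono) auto
    then show "v i \<bullet> x - real i * \<gamma> \<le> c - \<gamma>" using vx[OF i] by simp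
  qed
  moreover have "wall \<kappa> \<delta> \<alpha> N v x \<le> - (\<alpha> * \<delta> - (1 + \<alpha>) * sqrt (real N) * \<kappa>)"
    using wall_le_span[OF on order_refl k(2) par(1-5) pos r, of x] nx by simp
  ultimately have fx: "shielded_nemirovski \<kappa> \<gamma> \<delta> \<alpha> N v x \<le>
      max (c - \<gamma>) (- (\<alpha> * \<delta> - (1 + \<alpha>) * sqrt (real N) * \<kappa>))"
    unfolding shielded_nemirovski_def by linarith
  \<comment> \<open>The infimum is a lower bound only for a set that is bounded below; the term of
    \<open>v 1\<close> supplies the bound.\<close>
  have bdd: "bdd_below (shielded_nemirovski \<kappa> \<gamma> \<delta> \<alpha> N v ` cball 0 1)"
  proof (rule bdd_belowI2)
    fix z :: "real^'d" assume z: "z \<in> cball 0 1"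
    have "\<bar>v 1 \<bullet> z\<bar> \<le> norm (v 1) * norm z" by (rule Cauchy_Schwarz_ineq2)
    also have "norm (v 1) = 1" using k by (intro norm_orthonormal_frame[OF on]) auto
    finally have "- 1 \<le> v 1 \<bullet> z" using z by simp
    then show "- 1 - \<gamma> \<le> shielded_nemirovski \<kappa> \<gamma> \<delta> \<alpha> N v z"
      using nemirovski_ge[of 1 N v z \<gamma>] k unfolding shielded_nemirovski_def by simp
  qed
  have "(INF z\<in>cball 0 1. shielded_nemirovski \<kappa> \<gamma> \<delta> \<alpha> N v z) \<le> shielded_nemirovski \<kappa> \<gamma> \<delta> \<alpha> N v x"
    using nx by (intro cINF_lower[OF bdd]) simp
  then show ?thesis using fx by (simp add: c_def)
qed

section \<open>Parameter estimates\<close>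

lemma ln2_ge_069: "69 / 100 \<le> ln (2::real)"
  using ln_approx_bounds[of 2 2, simplified, simplified eval_nat_numeral, simplified] by simp

lemma delta_powr_alpha:
  fixes \<delta> \<alpha> :: real
  assumes "0 < \<delta>" "\<delta> < 1" "\<alpha> = 1 / log 2 (1 / \<delta>)"
  shows "\<delta> powr \<alpha> = 1 / 2" "0 < \<alpha>" "\<alpha> * - ln \<delta> = ln 2"
proof -
  have l: "ln \<delta> < 0" using assms by simp
  have a: "\<alpha> = ln 2 / - ln \<delta>" using assms by (simp add: log_def ln_div)
  then show "0 < \<alpha>" using l by (simp add: divide_pos_neg)
  show e: "\<alpha> * - ln \<delta> = ln 2" using a l by simp
  have "\<delta> powr \<alpha> = exp (- ln 2)" using e assms by (simp add: powr_def) 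
  then show "\<delta> powr \<alpha> = 1 / 2" by (simp add: exp_minus)
qed

text \<open>Since \<open>\<alpha> = ln 2 / - ln \<delta>\<close> grows with \<open>\<delta>\<close>,
  so does \<open>\<alpha> * \<delta>\<close>, which exceeds 9/5 at \<open>\<delta> = 3 / 4\<close>.
  The value of \<open>\<alpha>\<close> there is enclosed between 12/5 and 41/17 by comparing powers
  of 2 and 4/3.\<close>

lemma delta_alpha_small:
  fixes \<delta> \<alpha> :: real
  assumes "0 < \<delta>" "\<delta> < 1" "0 < \<alpha>" "\<alpha> * - ln \<delta> = ln 2" and le: "\<alpha> * \<delta> \<le> 9 / 5"
  shows "\<delta> \<le> 3 / 4" "\<alpha> \<le> 41 / 17"
proof -
  have l2: "ln (2::real) > 0" by simp
  have p: "ln (4/3::real) > 0" by simp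
  have "ln ((4/3::real) ^ 12) \<le> ln (2 ^ 5)" by (subst ln_le_cancel_iff) (simp_all add: power_divide)
  then have up: "12 * ln (4/3::real) \<le> 5 * ln 2"
    using ln_realpow[of "4/3::real" 12] ln_realpow[of "2::real" 5] by simp
  have "ln ((2::real) ^ 17) \<le> ln ((4/3) ^ 41)" by (subst ln_le_cancel_iff) (simp_all add: power_divide)
  then have lo: "17 * ln (2::real) \<le> 41 * ln (4/3)"
    using ln_realpow[of "4/3::real" 41] ln_realpow[of "2::real" 17] by simp
  show d: "\<delta> \<le> 3 / 4"
  proof (rule ccontr)
    assume "\<not> \<delta> \<le> 3 / 4"
    then have d: "3 / 4 < \<delta>" by simp
    then have "ln (3 / 4) < ln \<delta>" using assms by simp
    then have "- ln \<delta> < ln (4 / 3)" by (simp add: ln_div)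
    then have "\<alpha> * - ln \<delta> < \<alpha> * ln (4/3)" using assms(3) by (intro mult_strict_left_mono) 
    then have "12 * ln 2 < 12 * (\<alpha> * ln (4/3))" using assms(4) by simp
    also have "\<dots> = \<alpha> * (12 * ln (4/3))" by simp
    also have "\<dots> \<le> \<alpha> * (5 * ln 2)" using assms(3) up by (intro mult_left_mono) auto
    finally have "12 * ln 2 < (\<alpha> * 5) * ln (2::real)" by simp
    then have "12 / 5 < \<alpha>" using l2 by simp
    then have "12 / 5 * (3 / 4) < \<alpha> * \<delta>" using d by (intro mult_strict_mono) auto
    then show False using le by simp
  qed
  have "ln \<delta> \<le> ln (3 / 4)" using assms d by simp
  then have "ln (4 / 3) \<le> - ln \<delta>" by (simp add: ln_div)
  then have "\<alpha> * ln (4/3) \<le> \<alpha> * - ln \<delta>" using assms(3) by (intro mult_left_mono) auto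
  then have "\<alpha> * ln (4/3) \<le> ln 2" using assms(4) by simp
  then have "17 * (\<alpha> * ln (4/3)) \<le> 41 * ln (4/3)" using lo by linarith
  then have "(17 * \<alpha>) * ln (4/3::real) \<le> 41 * ln (4/3)" by simp
  then have "17 * \<alpha> \<le> 41" using p by (simp only: mult_le_cancel_right_pos)
  then show "\<alpha> \<le> 41 / 17" by simp
qed

text \<open>The final gap needs these estimates. Queried values are at least
  \<open>- (2 * real N + 1) * (\<delta> * \<kappa>)\<close>, while the minimum is at most the larger
  of \<open>- 1 / sqrt (real N) - 2 * \<delta> * \<kappa>\<close> and \<open>- (\<alpha> * \<delta>
  - (1 + \<alpha>) * sqrt (real N) * \<kappa>)\<close>; the first two inequalities put
  \<open>1 / (4 * sqrt (real N))\<close> in between.\<close>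

lemma shield_parameters:
  fixes N :: nat and \<kappa> \<delta> \<alpha> :: real
  assumes N: "2 \<le> N" and k0: "0 < \<kappa>" and k: "ln (real N) * real N * \<kappa> \<le> 1 / 4"
    and d: "0 < \<delta>" "\<delta> < 1" and a: "0 < \<alpha>" "\<alpha> * - ln \<delta> = ln 2"
    and ad: "\<alpha> * \<delta> = 4 * sqrt (real N) * \<kappa> + 1 / sqrt (real N)"
  shows "(2 * real N + 1) * (\<delta> * \<kappa>) + 1 / (4 * sqrt (real N)) \<le> \<alpha> * \<delta> - (1 + \<alpha>) * sqrt (real N) * \<kappa>"
    and "(2 * real N - 1) * (\<delta> * \<kappa>) \<le> 3 / (4 * sqrt (real N))"
    and "\<kappa> \<le> 1"
proof -
  define n s L where "n = real N" and "s = sqrt (real N)" and "L = ln (real N)"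
  have n2: "2 \<le> n" using N by (simp add: n_def)
  have ss: "s * s = n" by (simp add: s_def n_def)
  have s0: "0 < s" using N by (simp add: s_def)
  have s14: "141 / 100 \<le> s" using N unfolding s_def by (intro real_le_rsqrt) (auto simp: power2_eq_square)
  have "ln 2 \<le> L" using N by (simp add: L_def)
  then have L: "69 / 100 \<le> L" using ln2_ge_069 by linarith
  have k': "L * n * \<kappa> \<le> 1 / 4" using k by (simp add: L_def n_def)
  have adn: "\<alpha> * \<delta> = 4 * s * \<kappa> + 1 / s" using ad by (simp add: s_def)
  have sk: "4 * (s * \<kappa>) \<le> 1 / (s * L)"
  proof -
    have "4 * (s * \<kappa>) * (s * L) \<le> 1" using k' unfolding ss[symmetric] by (simp add: algebra_simps)
    then show ?thesis using s0 L by (simp add: pos_le_divide_eq)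
  qed
  have ad_le: "\<alpha> * \<delta> \<le> 1 / s * (1 + 1 / L)"
    using sk adn L s0 by (simp add: field_simps)
  have "1 / L \<le> 100 / 69" using L by (simp add: field_simps)
  moreover have "1 / s \<le> 100 / 141" using s14 by (simp add: field_simps)
  ultimately have "1 / s * (1 + 1 / L) \<le> 100 / 141 * (1 + 100 / 69)"
    using s0 L by (intro mult_mono) auto
  from order_trans[OF ad_le this] have "\<alpha> * \<delta> \<le> 9 / 5" by simp
  note da = delta_alpha_small[OF d a this]
  have "0.69 * 2 * \<kappa> \<le> L * n * \<kappa>" using L n2 k0 by (intro mult_mono) auto
  then have k18: "\<kappa> \<le> 25 / 138" using k' by simp
  then show "\<kappa> \<le> 1" by simp
  \<comment> \<open>Substituting \<open>adn\<close> turns the first claim into this form. The term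
    with \<open>3 - \<alpha>\<close> is positive because \<open>\<alpha> \<le> 41 / 17\<close>; it
    helps for \<open>N = 2\<close> and is dropped for larger \<open>N\<close>.\<close>
  have "(2 * n + 1) * (\<delta> * \<kappa>) \<le> 3 / (4 * s) + (3 - \<alpha>) * s * \<kappa> \<and> (2 * n - 1) * (\<delta> * \<kappa>) \<le> 3 / (4 * s)"
  proof (cases "N = 2")
    case True
    then have n: "n = 2" by (simp add: n_def)
    have s15: "s \<le> 1415 / 1000" unfolding s_def True by (intro real_le_lsqrt) (auto simp: power2_eq_square)
    have "3 / (4 * (1415/1000)) \<le> 3 / (4 * s)" using s0 s15 by (intro divide_left_mono) auto
    then have b: "53 / 100 \<le> 3 / (4 * s)" by simp
    have "\<delta> * \<kappa> \<le> 3 / 4 * \<kappa>" using da k0 by (intro mult_right_mono) auto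
    \<comment> \<open>The factor 10/17 is \<open>3 - 41 / 17\<close>, and 141/100 is the lower bound
      for \<open>s\<close>.\<close>
    moreover have "10 / 17 * (141/100) * \<kappa> \<le> (3 - \<alpha>) * s * \<kappa>"
      using da s14 k0 s0 by (intro mult_mono) auto
    moreover have "5 * p \<le> r + e" "3 * p \<le> r"
      if "p \<le> 3 / 4 * \<kappa>" "10 / 17 * (141/100) * \<kappa> \<le> e" "53 / 100 \<le> r" for p r e
      using that k18 k0 by linarith+
    ultimately have "5 * (\<delta> * \<kappa>) \<le> 3 / (4 * s) + (3 - \<alpha>) * s * \<kappa>"
      "3 * (\<delta> * \<kappa>) \<le> 3 / (4 * s)"
      using b by blast+
    moreover have "2 * n + 1 = 5" "2 * n - 1 = 3" using n by auto
    ultimately show ?thesis by simp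
  next
    case False
    then have N3: "3 \<le> N" using N by simp
    have main: "(2 * n + 1) * (\<delta> * \<kappa>) \<le> 3 / (4 * s)"
    proof (cases "N = 3")
      case True
      then have n: "n = 3" by (simp add: n_def)
      have "3 * ln (2::real) = ln (2 ^ 3)" by (subst ln_realpow) simp_all
      also have "\<dots> \<le> ln ((3::real) ^ 2)" by (subst ln_le_cancel_iff) simp_all
      also have "\<dots> = 2 * ln 3" by (subst ln_realpow) simp_all
      finally have "3 * ln (2::real) \<le> 2 * ln 3" .
      then have "102 / 100 \<le> L" using ln2_ge_069 True by (simp add: L_def)
      then have "102/100 * 3 * \<kappa> \<le> L * n * \<kappa>" using n k0 by (intro mult_right_mono) auto
      then have k8: "\<kappa> \<le> 25 / 306" using k' by simp
      have "s \<le> 1733 / 1000" unfolding s_def True by (intro real_le_lsqrt) (auto simp: power2_eq_square)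
      then have "3 / (4 * (1733/1000)) \<le> 3 / (4 * s)" using s0 by (intro divide_left_mono) auto
      moreover have "\<delta> * \<kappa> \<le> 3 / 4 * (25 / 306)" using da k8 k0 d by (intro mult_mono) auto
      ultimately show ?thesis unfolding n by simp
    next
      case False
      then have N4: "4 \<le> N" using N3 by simp
      then have n4: "4 \<le> n" by (simp add: n_def)
      have "ln ((2::real) ^ 2) \<le> L" using N4 by (simp add: L_def)
      then have "2 * ln 2 \<le> L" using ln_realpow[of "2::real" 2] by simp
      then have L4: "138 / 100 \<le> L" using ln2_ge_069 by simp
      \<comment> \<open>The split is at \<open>\<alpha> = 1\<close>. For
        \<open>\<alpha> \<le> 1\<close>, \<open>\<delta> \<ge> 1 / s\<close> gives
        \<open>- ln \<delta> \<le> L / 2\<close>, to be used in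
        \<open>\<delta> * ln 2 = \<alpha> * \<delta> * - ln \<delta>\<close>. For
        \<open>\<alpha> \<ge> 1\<close>, simply \<open>\<delta> \<le> \<alpha> * \<delta>\<close>.
        The constant 138/100 is below both \<open>2 * ln 2\<close> and \<open>L\<close>.\<close>
      have ds: "\<delta> * s \<le> (L + 1) * (100 / 138)"
      proof (cases "\<delta> \<le> 1 / 2")
        case True
        have "ln \<delta> \<le> ln (1 / 2)" using True d by simp
        then have "ln 2 \<le> - ln \<delta>" by (simp add: ln_div)
        then have "\<alpha> * ln 2 \<le> \<alpha> * - ln \<delta>" using a by (intro mult_left_mono) auto
        then have a1: "\<alpha> \<le> 1" using a by simp
        have "1 / s \<le> \<alpha> * \<delta>" using adn k0 s0 by simp
        also have "\<dots> \<le> 1 * \<delta>" using a1 d by (intro mult_right_mono) auto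
        finally have "ln (1 / s) \<le> ln \<delta>" using s0 d by simp
        then have ld: "- ln \<delta> \<le> L / 2"
          using s0 N by (simp add: ln_div L_def s_def ln_sqrt)
        have "\<delta> * s * ln 2 = (\<alpha> * \<delta>) * s * - ln \<delta>" using a by (metis mult.assoc mult.commute)
        also have "\<dots> \<le> (1 / s * (1 + 1 / L)) * s * (L / 2)"
          using s0 L d by (intro mult_mono[OF mult_right_mono[OF ad_le] ld]) auto
        also have "\<dots> = (L + 1) / 2" using s0 L by (simp add: field_simps)
        finally have 1: "\<delta> * s * ln 2 \<le> (L + 1) / 2" .
        have "\<delta> * s * (69/100) \<le> \<delta> * s * ln 2" using ln2_ge_069 d s0 by (intro mult_left_mono) auto
        then show ?thesis using 1 by simp
      next
        case False
        have "ln (1 / 2) < ln \<delta>" using False d by simp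
        then have "- ln \<delta> \<le> ln 2" by (simp add: ln_div)
        then have "\<alpha> * - ln \<delta> \<le> \<alpha> * ln 2" using a by (intro mult_left_mono) auto
        then have "1 * ln 2 \<le> \<alpha> * ln (2::real)" using a by simp
        then have a1: "1 \<le> \<alpha>" by simp
        have "1 * \<delta> \<le> \<alpha> * \<delta>" using a1 d by (intro mult_right_mono) auto
        then have "\<delta> \<le> 1 / s * (1 + 1 / L)" using ad_le by simp
        then have "\<delta> * s \<le> 1 / s * (1 + 1 / L) * s" using s0 by (intro mult_right_mono) auto
        also have "\<dots> = (L + 1) / L" using s0 L by (simp add: field_simps)
        also have "\<dots> \<le> (L + 1) / (138 / 100)" using L4 by (intro divide_left_mono) auto
        finally show ?thesis by simp
      qed
      have k4: "4 * \<kappa> \<le> 1 / (n * L)" using k' n4 L by (simp add: field_simps)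
      have "(2 * n + 1) * (\<delta> * \<kappa>) * (4 * s) = (2 * n + 1) * (\<delta> * s) * (4 * \<kappa>)" by simp
      \<comment> \<open>Here \<open>2 * n + 1 \<le> 9 / 4 * n\<close> because
        \<open>n \<ge> 4\<close>.\<close>
      also have "\<dots> \<le> (9 / 4 * n) * ((L + 1) * (100 / 138)) * (1 / (n * L))"
        using n4 d s0 k0 L by (intro mult_mono[OF mult_mono[OF _ ds] k4]) auto
      also have "\<dots> = 900 / 552 * ((L + 1) / L)" using n4 L by (simp add: field_simps)
      also have "\<dots> \<le> 3" using L4 by (simp add: field_simps)
      finally show ?thesis using s0 by (simp add: field_simps)
    qed
    have "0 \<le> (3 - \<alpha>) * s * \<kappa>" using da s0 k0 by simp
    moreover have "(2 * n - 1) * (\<delta> * \<kappa>) \<le> (2 * n + 1) * (\<delta> * \<kappa>)"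
      using d k0 by (intro mult_right_mono) auto
    ultimately show ?thesis using main by linarith
  qed
  then have 1: "(2 * n + 1) * (\<delta> * \<kappa>) \<le> 3 / (4 * s) + (3 - \<alpha>) * s * \<kappa>"
    and 2: "(2 * n - 1) * (\<delta> * \<kappa>) \<le> 3 / (4 * s)" by auto
  show "(2 * real N - 1) * (\<delta> * \<kappa>) \<le> 3 / (4 * sqrt (real N))" using 2 by (simp add: n_def s_def)
  have "3 / (4 * s) + (3 - \<alpha>) * s * \<kappa> + 1 / (4 * s) = \<alpha> * \<delta> - (1 + \<alpha>) * s * \<kappa>"
    unfolding adn using s0 by (simp add: field_simps)
  then show "(2 * real N + 1) * (\<delta> * \<kappa>) + 1 / (4 * sqrt (real N)) \<le> \<alpha> * \<delta> - (1 + \<alpha>) * sqrt (real N) * \<kappa>"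
    using 1 by (simp add: n_def s_def)
qed

section \<open>Haar-distributed frames\<close>

text \<open>A nonzero residual would extend the frame to \<open>CARD('d) + 1\<close> pairwise
  orthogonal nonzero, hence independent, vectors.\<close>

lemma sum_scaleR_orthonormal_basis:
  fixes v :: "nat \<Rightarrow> real^'d"
  assumes on: "orthonormal_frame CARD('d) v"
  shows "(\<Sum>j\<in>{1..CARD('d)}. (v j \<bullet> x) *\<^sub>R v j) = x"
proof -
  have "frame_resid CARD('d) v x = 0"
  proof (rule ccontr)
    define z where "z = frame_resid CARD('d) v x"
    assume "frame_resid CARD('d) v x \<noteq> 0"
    then have z: "z \<noteq> 0" by (simp add: z_def)
    have vz: "v i \<bullet> z = 0" if "i \<in> {1..CARD('d)}" for i
      using inner_frame_resid_low[OF on that] by (simp add: z_def)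
    have inj: "inj_on v {1..CARD('d)}"
      using orthonormal_frameD[OF on] by (intro inj_onI) (metis zero_neq_one)
    let ?B = "insert z (v ` {1..CARD('d)})"
    have "z \<notin> v ` {1..CARD('d)}" using vz z by (metis imageE inner_eq_zero_iff)
    then have "card ?B = Suc CARD('d)" using card_image[OF inj] by simp
    moreover have "independent ?B"
    proof (rule pairwise_orthogonal_independent)
      show "pairwise orthogonal ?B"
        using orthonormal_frameD[OF on] vz
        by (auto simp: pairwise_def orthogonal_def inner_commute)
      show "0 \<notin> ?B" using z norm_orthonormal_frame[OF on] by (metis imageE insertE norm_zero zero_neq_one)
    qed
    then have "card ?B \<le> DIM(real^'d)" using independent_card_le by blast
    ultimately show False by simp
  qed
  then show ?thesis by (simp add: frame_resid_def)
qed

section \<open>Orthogonal maps taking one frame to another\<close>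

lemma extend_orthonormal_frame:
  fixes v :: "nat \<Rightarrow> real^'d"
  assumes "orthonormal_frame k v" "k \<le> m" "m \<le> CARD('d)"
  shows "\<exists>w. orthonormal_frame m w \<and> (\<forall>i\<in>{1..k}. w i = v i)"
  using assms(2,3)
proof (induction m rule: dec_induct)
  case base
  then show ?case using assms(1) by blast
next
  case (step m)
  then obtain w where w: "orthonormal_frame m w" "\<forall>i\<in>{1..k}. w i = v i" by auto
  obtain a where a: "norm a = 1" "\<And>i. i \<in> {1..m} \<Longrightarrow> w i \<bullet> a = 0"
    using exists_orthogonal_unit[of m w] step by auto
  have "orthonormal_frame (Suc m) (w(Suc m := a))"
    using w(1) a unfolding orthonormal_frame_def
    by (auto simp: inner_commute norm_eq_1 le_Suc_eq)
  moreover have "\<forall>i\<in>{1..k}. (w(Suc m := a)) i = v i" using w(2) step(1) by simp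
  ultimately show ?case by blast
qed

text \<open>For an orthonormal basis \<open>v\<close> this is the linear map taking each
  \<open>v j\<close> to \<open>w j\<close>. As an explicit sum it is measurable in the frames as
  well as in \<open>x\<close>.\<close>

definition frame_map :: "(nat \<Rightarrow> real^'d) \<Rightarrow> (nat \<Rightarrow> real^'d) \<Rightarrow> real^'d \<Rightarrow> real^'d" where
  "frame_map v w x = (\<Sum>j\<in>{1..CARD('d)}. (v j \<bullet> x) *\<^sub>R w j)"

lemma orthogonal_transformation_frame_map:
  fixes v w :: "nat \<Rightarrow> real^'d"
  assumes v: "orthonormal_frame CARD('d) v" and w: "orthonormal_frame CARD('d) w"
  shows "orthogonal_transformation (frame_map v w)"
proof -
  have lin: "linear (frame_map v w)"
    by (auto intro!: linearI simp: frame_map_def inner_add_right scaleR_add_left sum.distrib scaleR_sum_right)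
  have wT: "w i \<bullet> frame_map v w x = v i \<bullet> x" if "i \<in> {1..CARD('d)}" for i x
    using inner_frame_sum[OF w that order_refl, of "\<lambda>j. v j \<bullet> x"] that by (simp add: frame_map_def)
  have "frame_map v w x \<bullet> frame_map v w y = x \<bullet> y" for x y
  proof -
    have "frame_map v w x \<bullet> frame_map v w y = (\<Sum>j\<in>{1..CARD('d)}. (v j \<bullet> x) * (w j \<bullet> frame_map v w y))"
      by (simp add: frame_map_def[of v w x] inner_sum_left)
    also have "\<dots> = (\<Sum>j\<in>{1..CARD('d)}. (v j \<bullet> x) * (v j \<bullet> y))"
      using wT by simp
    also have "\<dots> = (\<Sum>j\<in>{1..CARD('d)}. (v j \<bullet> x) *\<^sub>R v j) \<bullet> y"
      by (simp add: inner_sum_left)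
    finally show ?thesis by (simp only: sum_scaleR_orthonormal_basis[OF v])
  qed
  then show ?thesis using lin by (simp add: orthogonal_transformation_def)
qed

lemma frame_map_apply:
  fixes v w :: "nat \<Rightarrow> real^'d"
  assumes v: "orthonormal_frame CARD('d) v" and i: "i \<in> {1..CARD('d)}"
  shows "frame_map v w (v i) = w i"
proof -
  have "frame_map v w (v i) = (\<Sum>j\<in>{1..CARD('d)}. (if j = i then 1 else 0) *\<^sub>R w j)"
    unfolding frame_map_def using orthonormal_frameD[OF v _ i] by (intro sum.cong) auto
  also have "\<dots> = w i" using i by (simp add: if_distrib[of "\<lambda>c. c *\<^sub>R _"] cong: if_cong)
  finally show ?thesis .
qed

lemma orthogonal_transformation_between_frames:
  fixes v w :: "nat \<Rightarrow> real^'d"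
  assumes v: "orthonormal_frame N v" and w: "orthonormal_frame N w" and N: "N \<le> CARD('d)"
  obtains T where "orthogonal_transformation T" "\<And>i. i \<in> {1..N} \<Longrightarrow> T (v i) = w i"
proof -
  obtain v' where v': "orthonormal_frame CARD('d) v'" "\<forall>i\<in>{1..N}. v' i = v i"
    using extend_orthonormal_frame[OF v N order_refl] by blast
  obtain w' where w': "orthonormal_frame CARD('d) w'" "\<forall>i\<in>{1..N}. w' i = w i"
    using extend_orthonormal_frame[OF w N order_refl] by blast
  have "frame_map v' w' (v i) = w i" if "i \<in> {1..N}" for i
    using frame_map_apply[OF v'(1), of i w'] v'(2) w'(2) that N by simp
  then show ?thesis
    using that orthogonal_transformation_frame_map[OF v'(1) w'(1)] by blast
qed

section \<open>The action of orthogonal maps on frames and its invariant laws\<close>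

lemma orthonormal_frame_image:
  assumes "orthogonal_transformation T" "orthonormal_frame N v"
  shows "orthonormal_frame N (\<lambda>i. T (v i))"
  using assms unfolding orthonormal_frame_def orthogonal_transformation_def by simp

lemma borel_measurable_orthogonal:
  fixes T :: "real^'d \<Rightarrow> real^'d"
  assumes "orthogonal_transformation T"
  shows "T \<in> borel_measurable borel"
  using assms by (intro borel_measurable_continuous_onI linear_continuous_on linear_conv_bounded_linear[THEN iffD1])
    (simp add: orthogonal_transformation_def)

abbreviation frame_space :: "nat \<Rightarrow> (nat \<Rightarrow> real^'d) measure" where
  "frame_space N \<equiv> PiM {1..N} (\<lambda>_. borel)"

text \<open>The restriction keeps the result in the space of the product measure, whose elements are
  \<open>undefined\<close> outside the index set.\<close>

definition act :: "nat \<Rightarrow> (real^'d \<Rightarrow> real^'d) \<Rightarrow> (nat \<Rightarrow> real^'d) \<Rightarrow> nat \<Rightarrow> real^'d" where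
  "act N T v = (\<lambda>i\<in>{1..N}. T (v i))"

lemma act_measurable:
  assumes "orthogonal_transformation T"
  shows "act N T \<in> frame_space N \<rightarrow>\<^sub>M frame_space N"
  unfolding act_def
  by (intro measurable_restrict measurable_compose[OF _ borel_measurable_orthogonal[OF assms]]
      measurable_component_singleton)

context
  fixes N :: nat and V :: "(nat \<Rightarrow> real^'d) measure"
  assumes haar: "haar_frames N V"
begin

lemma haar_prob: "prob_space V" using haar by (simp add: haar_frames_def)

lemma haar_sets: "sets V = sets (frame_space N)" using haar by (simp add: haar_frames_def)

lemma haar_space: "space V = space (frame_space N)" using sets_eq_imp_space_eq[OF haar_sets] .

lemma haar_measurable_iff: "f \<in> V \<rightarrow>\<^sub>M M \<longleftrightarrow> f \<in> frame_space N \<rightarrow>\<^sub>M M"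
  using measurable_cong_sets[OF haar_sets refl] by blast

lemma haar_ae: "AE v in V. orthonormal_frame N v" using haar by (simp add: haar_frames_def)

lemma haar_distr:
  assumes "orthogonal_transformation T"
  shows "distr V (frame_space N) (act N T) = V"
proof -
  have "distr V (frame_space N) (act N T) = distr V V (act N T)"
    by (rule distr_cong) (simp_all add: haar_sets)
  then show ?thesis using haar assms unfolding haar_frames_def act_def by simp
qed

lemma haar_component_measurable:
  "i \<in> {1..N} \<Longrightarrow> (\<lambda>v. v i) \<in> borel_measurable V"
  unfolding haar_measurable_iff by (rule measurable_component_singleton)

end

text \<open>Along the curve of powers of \<open>t\<close> the inner product with \<open>x\<close> is
  a polynomial in \<open>t\<close> whose coefficients are the coordinates of \<open>x\<close>, so it
  has few roots unless \<open>x = 0\<close>.\<close>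

lemma moment_curve_hyperplanes:
  obtains a :: "real \<Rightarrow> real^'d" where "\<And>t. a t \<noteq> 0"
    "\<And>x. x \<noteq> 0 \<Longrightarrow> finite {t. a t \<bullet> x = 0} \<and> card {t. a t \<bullet> x = 0} \<le> CARD('d)"
proof -
  obtain h :: "'d \<Rightarrow> nat" where h: "bij_betw h UNIV {0..<CARD('d)}"
    using ex_bij_betw_finite_nat[of "UNIV :: 'd set"] by auto
  have inj: "inj h" using h by (rule bij_betw_imp_inj_on)
  have hb: "h i < CARD('d)" for i using h by (auto simp: bij_betw_def)
  \<comment> \<open>The coordinate with exponent 0 is constantly 1, even at \<open>t = 0\<close>, so
    the curve avoids the origin.\<close>
  obtain i0 where i0: "h i0 = 0"
    using h by (metis atLeast0LessThan bij_betw_iff_bijections lessThan_iff zero_less_card_finite)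
  define a :: "real \<Rightarrow> real^'d" where "a t = (\<chi> i. t ^ h i)" for t
  show ?thesis
  proof (rule that[of a])
    show "a t \<noteq> 0" for t
      using i0 by (auto simp: a_def vec_eq_iff intro!: exI[of _ i0])
    fix x :: "real^'d" assume x: "x \<noteq> 0"
    define p where "p = (\<Sum>i\<in>UNIV. monom (x $ i) (h i))"
    have pt: "poly p t = a t \<bullet> x" for t
      by (simp add: p_def a_def poly_sum poly_monom inner_vec_def mult.commute)
    obtain i where i: "x $ i \<noteq> 0" using x by (auto simp: vec_eq_iff)
    have "coeff p (h i) = (\<Sum>j\<in>UNIV. if j = i then x $ j else 0)"
      using inj by (auto simp: p_def coeff_sum inj_eq intro!: sum.cong)
    then have "coeff p (h i) \<noteq> 0" using i by simp
    then have p0: "p \<noteq> 0" by auto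
    have deg: "degree p \<le> CARD('d)"
      unfolding p_def using hb by (intro degree_sum_le order_trans[OF degree_monom_le]) (auto intro: less_imp_le)
    show "finite {t. a t \<bullet> x = 0} \<and> card {t. a t \<bullet> x = 0} \<le> CARD('d)"
      using poly_roots_finite[OF p0] card_poly_roots_bound[OF p0] deg by (simp add: pt)
  qed
qed

text \<open>By invariance all hyperplanes have the same probability of containing \<open>v\<^sub>1\<close>, and a nonzero vector
  lies in boundedly many of the infinitely many hyperplanes orthogonal to the moment curve.\<close>

lemma haar_hyperplane_null:
  fixes V :: "(nat \<Rightarrow> real^'d) measure"
  assumes haar: "haar_frames N V" and N: "1 \<le> N" and b: "b \<noteq> 0"
  shows "AE v in V. b \<bullet> v 1 \<noteq> 0"
proof -
  interpret prob_space V by (rule haar_prob[OF haar])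
  have meas1 [measurable]: "(\<lambda>v. v 1) \<in> borel_measurable V"
    using haar_component_measurable[OF haar, of 1] N by simp
  define H where "H a = {v \<in> space V. a \<bullet> v 1 = 0}" for a
  have Hm [measurable]: "H a \<in> sets V" for a unfolding H_def by measurable
  have eq: "prob (H a) = prob (H b)" if a: "a \<noteq> 0" for a
  proof -
    have "norm (a /\<^sub>R norm a) = norm (b /\<^sub>R norm b)" using a b by simp
    then obtain T where T: "orthogonal_transformation T" "T (a /\<^sub>R norm a) = b /\<^sub>R norm b"
      using orthogonal_transformation_exists by metis
    have am: "act N T \<in> V \<rightarrow>\<^sub>M frame_space N"
      using act_measurable[OF T(1)] haar_measurable_iff[OF haar] by blast
    have "prob (H b) = measure (distr V (frame_space N) (act N T)) (H b)"
      unfolding haar_distr[OF haar T(1)] ..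
    also have "\<dots> = prob (act N T -` H b \<inter> space V)"
      using Hm haar_sets[OF haar] by (intro measure_distr am) simp
    also have "act N T -` H b \<inter> space V = H a"
    proof -
      have "b \<bullet> T x = 0 \<longleftrightarrow> a \<bullet> x = 0" for x
      proof -
        have "(b /\<^sub>R norm b) \<bullet> T x = (a /\<^sub>R norm a) \<bullet> x"
          using T unfolding orthogonal_transformation_def by metis
        then show ?thesis using a b by (auto simp: divide_simps split: if_splits)
      qed
      moreover have "act N T v \<in> space V" if "v \<in> space V" for v
        using measurable_space[OF am that] haar_space[OF haar] by simp
      ultimately show ?thesis using N by (auto simp: H_def act_def)
    qed
    finally show ?thesis by simp
  qed
  obtain a :: "real \<Rightarrow> real^'d" where a: "\<And>t. a t \<noteq> 0"
    "\<And>x. x \<noteq> 0 \<Longrightarrow> finite {t. a t \<bullet> x = 0} \<and> card {t. a t \<bullet> x = 0} \<le> CARD('d)"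
    using moment_curve_hyperplanes by blast
  \<comment> \<open>The left side is the expected number of hyperplanes, among \<open>m\<close> of
    the curve, that contain \<open>v 1\<close>; this number is almost surely at most the
    dimension.\<close>
  have bound: "real m * prob (H b) \<le> real CARD('d)" for m
  proof -
    have "real m * prob (H b) = (\<Sum>t<m. expectation (indicator (H (a (real t)))))"
      using eq[OF a(1)] by simp
    also have "\<dots> = expectation (\<lambda>v. \<Sum>t<m. indicator (H (a (real t))) v)"
      by (intro Bochner_Integration.integral_sum[symmetric]) (simp add: integrable_indicator_iff emeasure_eq_measure)
    also have "\<dots> \<le> expectation (\<lambda>v. real CARD('d))"
    proof (rule integral_mono_AE)
      show "integrable V (\<lambda>v. \<Sum>t<m. indicator (H (a (real t))) v :: real)"
        by (intro Bochner_Integration.integrable_sum) (simp add: integrable_indicator_iff emeasure_eq_measure)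
      show "AE v in V. (\<Sum>t<m. indicator (H (a (real t))) v) \<le> real CARD('d)"
        using haar_ae[OF haar]
      proof eventually_elim
        case (elim v)
        have "norm (v 1) = 1" using N by (intro norm_orthonormal_frame[OF elim]) simp
        then have v: "v 1 \<noteq> 0" by auto
        have "(\<Sum>t<m. indicator (H (a (real t))) v :: real) = card {t\<in>{..<m}. v \<in> H (a (real t))}"
          by (simp add: indicator_def sum.If_cases Int_def)
        also have "card {t\<in>{..<m}. v \<in> H (a (real t))} = card (real ` {t\<in>{..<m}. v \<in> H (a (real t))})"
          by (subst card_image) auto
        also have "\<dots> \<le> card {t. a t \<bullet> v 1 = 0}"
          using a(2)[OF v] by (intro card_mono) (auto simp: H_def)
        also have "\<dots> \<le> CARD('d)" using a(2)[OF v] by simp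
        finally show ?case by simp
      qed
    qed simp
    finally show ?thesis by (simp add: prob_space)
  qed
  have "prob (H b) = 0"
  proof (rule ccontr)
    assume "prob (H b) \<noteq> 0"
    then have "prob (H b) > 0" by (simp add: measure_nonneg less_le)
    then obtain m where "real CARD('d) < real m * prob (H b)"
      using reals_Archimedean3 by blast
    then show False using bound[of m] by simp
  qed
  then have "AE v in V. v \<notin> H b"
    using prob_eq_0[OF Hm] by simp
  then show ?thesis
    using AE_space by eventually_elim (simp add: H_def)
qed

section \<open>Gram-Schmidt steps from a Haar frame to a Haar orthonormal basis\<close>

definition frame_extend :: "nat \<Rightarrow> (nat \<Rightarrow> real^'d) \<Rightarrow> real^'d \<Rightarrow> nat \<Rightarrow> real^'d" where
  "frame_extend n w x =
     (\<lambda>i\<in>{1..Suc n}. if i = Suc n then frame_resid n w x /\<^sub>R norm (frame_resid n w x) else w i)"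

lemma orthonormal_frame_extend:
  assumes "orthonormal_frame n w" "frame_resid n w x \<noteq> 0"
  shows "orthonormal_frame (Suc n) (frame_extend n w x)"
proof -
  define u where "u = frame_resid n w x /\<^sub>R norm (frame_resid n w x)"
  have u: "u \<bullet> u = 1" using assms(2) unfolding norm_eq_1[symmetric] by (simp add: u_def)
  have wu: "w i \<bullet> u = 0" if "i \<in> {1..n}" for i
    using inner_frame_resid_low[OF assms(1) that] by (simp add: u_def)
  have "orthonormal_frame (Suc n) (\<lambda>i. if i = Suc n then u else w i)"
    using assms(1) u wu unfolding orthonormal_frame_def
    by (auto simp: inner_commute le_Suc_eq)
  then show ?thesis
    by (subst orthonormal_frame_cong[of _ _ "\<lambda>i. if i = Suc n then u else w i"])
      (auto simp: frame_extend_def u_def)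
qed

lemma frame_resid_image:
  assumes "orthogonal_transformation T"
  shows "frame_resid n (\<lambda>i. T (w i)) (T x) = T (frame_resid n w x)"
  using assms unfolding frame_resid_def orthogonal_transformation_def
  by (simp add: linear_diff linear_sum linear_cmul)

text \<open>Gram-Schmidt commutes with orthogonal maps, which passes invariance on to the law of the
  longer frame.\<close>

lemma frame_extend_image:
  assumes "orthogonal_transformation T"
  shows "frame_extend n (act n T w) (T x) = act (Suc n) T (frame_extend n w x)"
proof -
  have "frame_resid n (act n T w) (T x) = T (frame_resid n w x)"
    unfolding frame_resid_image[OF assms, symmetric] by (rule frame_resid_cong) (simp add: act_def)
  then show ?thesis
    using assms unfolding frame_extend_def act_def
    by (intro restrict_ext) (auto simp: orthogonal_transformation_norm orthogonal_transformation_scaleR)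
qed

text \<open>Draw a frame from \<open>W\<close> and, independently, one from \<open>V\<close>, and
  append the normalised residual of the first vector of the latter. \<open>V\<close> serves only as
  a source of a rotation invariant unit vector.\<close>

lemma haar_frames_Suc:
  fixes V :: "(nat \<Rightarrow> real^'d) measure" and W :: "(nat \<Rightarrow> real^'d) measure"
  assumes V: "haar_frames N V" "1 \<le> N" and W: "haar_frames n W" and n: "n < CARD('d)"
  shows "\<exists>W' :: (nat \<Rightarrow> real^'d) measure. haar_frames (Suc n) W'"
proof -
  interpret V: prob_space V by (rule haar_prob[OF V(1)])
  interpret W: prob_space W by (rule haar_prob[OF W])
  interpret P: pair_prob_space W V ..
  have m1 [measurable]: "(\<lambda>v. v 1) \<in> borel_measurable V"
    using haar_component_measurable[OF V(1), of 1] V(2) by simp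
  note [measurable] = haar_component_measurable[OF W]
  have res [measurable]: "(\<lambda>p. frame_resid n (fst p) (snd p 1)) \<in> borel_measurable (W \<Otimes>\<^sub>M V)"
    unfolding frame_resid_def by measurable
  define F :: "_ \<Rightarrow> nat \<Rightarrow> real^'d" where "F = (\<lambda>p :: (nat \<Rightarrow> real^'d) \<times> (nat \<Rightarrow> real^'d). frame_extend n (fst p) (snd p 1))"
  have F [measurable]: "F \<in> (W \<Otimes>\<^sub>M V) \<rightarrow>\<^sub>M frame_space (Suc n)"
    unfolding F_def frame_extend_def
  proof (rule measurable_restrict)
    fix i assume i: "i \<in> {1..Suc n}"
    show "(\<lambda>p. if i = Suc n then frame_resid n (fst p) (snd p 1) /\<^sub>R norm (frame_resid n (fst p) (snd p 1))
        else fst p i) \<in> borel_measurable (W \<Otimes>\<^sub>M V)"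
    proof (cases "i = Suc n")
      case False
      then show ?thesis
        using i measurable_compose[OF measurable_fst haar_component_measurable[OF W, of i], of V] by simp
    next
      case True
      then show ?thesis by (simp del: One_nat_def)
    qed
  qed
  define W' where "W' = distr (W \<Otimes>\<^sub>M V) (frame_space (Suc n)) F"
  have "prob_space W'" unfolding W'_def by (rule P.prob_space_distr[OF F])
  moreover have sets: "sets W' = sets (frame_space (Suc n))" by (simp add: W'_def)
  moreover have "AE v in W'. orthonormal_frame (Suc n) v"
  proof -
    have onm: "{v :: nat \<Rightarrow> real^'d. v \<in> space (frame_space (Suc n)) \<and> orthonormal_frame (Suc n) v} \<in> sets (frame_space (Suc n))"
      unfolding orthonormal_frame_def by measurable
    have pm: "{p \<in> space (W \<Otimes>\<^sub>M V). orthonormal_frame n (fst p) \<and> frame_resid n (fst p) (snd p 1) \<noteq> 0} \<in> sets (W \<Otimes>\<^sub>M V)"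
      unfolding orthonormal_frame_def by measurable
    have "AE w in W. AE v in V. orthonormal_frame n w \<and> frame_resid n w (v 1) \<noteq> 0"
      using haar_ae[OF W]
    proof eventually_elim
      case (elim w)
      \<comment> \<open>A vanishing residual would put \<open>v 1\<close> into the hyperplane
        orthogonal to \<open>b\<close>, which is a null event.\<close>
      obtain b where b: "norm b = 1" "\<And>i. i \<in> {1..n} \<Longrightarrow> w i \<bullet> b = 0"
        using exists_orthogonal_unit[OF n, of w] by blast
      have "b \<bullet> frame_resid n w x = b \<bullet> x" for x
        using b(2) by (simp add: frame_resid_def inner_diff_right inner_sum_right inner_commute[of b])
      then have "frame_resid n w x \<noteq> 0" if "b \<bullet> x \<noteq> 0" for x
        using that by (metis inner_zero_right)
      moreover have "AE v in V. b \<bullet> v 1 \<noteq> 0"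
        using b(1) by (intro haar_hyperplane_null[OF V]) auto
      ultimately show ?case using elim by auto
    qed
    then have "AE p in W \<Otimes>\<^sub>M V. orthonormal_frame n (fst p) \<and> frame_resid n (fst p) (snd p 1) \<noteq> 0"
      by (intro P.AE_pair_measure pm) simp
    then have "AE p in W \<Otimes>\<^sub>M V. orthonormal_frame (Suc n) (F p)"
      by eventually_elim (simp add: F_def orthonormal_frame_extend)
    then show ?thesis unfolding W'_def by (subst AE_distr_iff[OF F]) (use onm in auto)
  qed
  moreover have "distr W' W' (\<lambda>v. \<lambda>i\<in>{1..Suc n}. T (v i)) = W'" if T: "orthogonal_transformation T" for T
  proof -
    have aW [measurable]: "act n T \<in> W \<rightarrow>\<^sub>M frame_space n" 
      using act_measurable[OF T] haar_measurable_iff[OF W] by blast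
    have aV [measurable]: "act N T \<in> V \<rightarrow>\<^sub>M frame_space N" 
      using act_measurable[OF T] haar_measurable_iff[OF V(1)] by blast
    \<comment> \<open>Rotating both independent draws by the same \<open>T\<close> preserves their
      joint law.\<close>
    have "W \<Otimes>\<^sub>M V = distr W (frame_space n) (act n T) \<Otimes>\<^sub>M distr V (frame_space N) (act N T)"
      unfolding haar_distr[OF W T] haar_distr[OF V(1) T] ..
    also have "\<dots> = distr (W \<Otimes>\<^sub>M V) (frame_space n \<Otimes>\<^sub>M frame_space N) (\<lambda>(x, y). (act n T x, act N T y))"
      by (rule pair_measure_distr[OF aW aV])
        (unfold haar_distr[OF V(1) T], rule V.sigma_finite_measure_axioms)
    finally have PP: "W \<Otimes>\<^sub>M V = distr (W \<Otimes>\<^sub>M V) (frame_space n \<Otimes>\<^sub>M frame_space N) (\<lambda>(x, y). (act n T x, act N T y))" .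
    have F': "F \<in> (frame_space n \<Otimes>\<^sub>M frame_space N) \<rightarrow>\<^sub>M frame_space (Suc n)"
      using F measurable_cong_sets[OF sets_pair_measure_cong[OF haar_sets[OF W] haar_sets[OF V(1)]] refl] by blast
    have "W' = distr (distr (W \<Otimes>\<^sub>M V) (frame_space n \<Otimes>\<^sub>M frame_space N) (\<lambda>(x, y). (act n T x, act N T y)))
       (frame_space (Suc n)) F"
      using PP by (simp add: W'_def)
    also have "\<dots> = distr (W \<Otimes>\<^sub>M V) (frame_space (Suc n)) (F \<circ> (\<lambda>(x, y). (act n T x, act N T y)))"
      by (intro distr_distr F') measurable
    also have "F \<circ> (\<lambda>(x, y). (act n T x, act N T y)) = act (Suc n) T \<circ> F"
    proof
      fix p :: "(nat \<Rightarrow> real^'d) \<times> (nat \<Rightarrow> real^'d)"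
      have "act N T (snd p) 1 = T (snd p 1)" using V(2) by (simp add: act_def)
      then show "(F \<circ> (\<lambda>(x, y). (act n T x, act N T y))) p = (act (Suc n) T \<circ> F) p"
        using frame_extend_image[OF T, of n "fst p" "snd p 1"] by (simp add: F_def split_beta)
    qed
    also have "distr (W \<Otimes>\<^sub>M V) (frame_space (Suc n)) (act (Suc n) T \<circ> F) =
        distr W' (frame_space (Suc n)) (act (Suc n) T)"
      unfolding W'_def by (intro distr_distr[symmetric] act_measurable[OF T] F)
    also have "\<dots> = distr W' W' (act (Suc n) T)" by (rule distr_cong) (simp_all add: sets)
    finally show ?thesis unfolding act_def by simp
  qed
  ultimately show ?thesis unfolding haar_frames_def by blast
qed

text \<open>A Haar orthonormal basis encodes a random orthogonal map, which the tail bound needs;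
  \<open>V\<close> itself supplies the randomness for every added vector.\<close>

lemma haar_frames_full_exists:
  fixes V :: "(nat \<Rightarrow> real^'d) measure"
  assumes V: "haar_frames N V" "1 \<le> N" "N \<le> CARD('d)"
  shows "\<exists>W :: (nat \<Rightarrow> real^'d) measure. haar_frames CARD('d) W"
proof -
  have "\<exists>W :: (nat \<Rightarrow> real^'d) measure. haar_frames m W" if "N \<le> m" "m \<le> CARD('d)" for m
    using that
  proof (induction m rule: dec_induct)
    case base
    then show ?case using V by blast
  next
    case (step m)
    then show ?case using haar_frames_Suc[OF V(1,2)] by (meson Suc_le_lessD less_imp_le)
  qed
  then show ?thesis using V(3) by blast
qed

section \<open>Tail bound for correlated queries\<close>

lemma exp_plus_exp_minus_le: "exp x + exp (- x) \<le> 2 * exp (x\<^sup>2 / 2)" for x :: real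
proof -
  have *: "exp y + exp (- y) \<le> 2 * exp (y\<^sup>2 / 2)" if "0 \<le> y" for y :: real
  proof -
    have e: "1 + 1 / 2 * (exp (2 * y) - 1) = (1 + exp (2 * y)) / 2" by (simp add: field_simps)
    have p: "0 < (1 + exp (2 * y)) / 2" by (intro divide_pos_pos add_pos_pos) auto
    \<comment> \<open>The two-point case of Hoeffding's lemma with step \<open>2 * y\<close> and
      probability 1/2; centring produces the \<open>- y\<close>.\<close>
    have "- y + ln ((1 + exp (2 * y)) / 2) \<le> y\<^sup>2 / 2"
      using Hoeffdings_lemma_aux[of "2 * y" "1 / 2"] that unfolding e by (simp add: power2_eq_square)
    then have "exp (- y + ln ((1 + exp (2 * y)) / 2)) \<le> exp (y\<^sup>2 / 2)" by simp
    then have "exp (- y) * ((1 + exp (2 * y)) / 2) \<le> exp (y\<^sup>2 / 2)"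
      unfolding exp_add exp_ln[OF p] .
    moreover have "exp (- y) * exp (2 * y) = exp y" by (simp flip: exp_add)
    ultimately show ?thesis by (simp add: algebra_simps)
  qed
  show ?thesis using *[of x] *[of "- x"] by (cases "0 \<le> x") (auto simp: add.commute)
qed

text \<open>The exponential of the sum factorises over the coordinates. Summing over
  \<open>PiE\<close> stands for a probability space of independent fair signs, up to the factor
  \<open>2 ^ card J\<close>.\<close>

lemma sum_signs_exp_le:
  fixes a :: "nat \<Rightarrow> real"
  assumes "finite J"
  shows "(\<Sum>\<epsilon>\<in>PiE J (\<lambda>_. {-1, 1}). exp (\<Sum>j\<in>J. \<epsilon> j * a j)) \<le> 2 ^ card J * exp ((\<Sum>j\<in>J. (a j)\<^sup>2) / 2)"
proof -
  have "(\<Sum>\<epsilon>\<in>PiE J (\<lambda>_. {-1, 1::real}). exp (\<Sum>j\<in>J. \<epsilon> j * a j)) =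
      (\<Sum>\<epsilon>\<in>PiE J (\<lambda>_. {-1, 1}). \<Prod>j\<in>J. exp (\<epsilon> j * a j))"
    using assms by (simp add: exp_sum)
  also have "\<dots> = (\<Prod>j\<in>J. \<Sum>s\<in>{-1, 1}. exp (s * a j))"
    using assms by (intro prod_sum_PiE[symmetric]) auto
  also have "\<dots> \<le> (\<Prod>j\<in>J. 2 * exp ((a j)\<^sup>2 / 2))"
    using exp_plus_exp_minus_le by (intro prod_mono) (auto simp: add.commute intro: add_nonneg_nonneg)
  also have "\<dots> = 2 ^ card J * exp ((\<Sum>j\<in>J. (a j)\<^sup>2) / 2)"
    using assms by (simp add: prod.distrib exp_sum sum_divide_distrib)
  finally show ?thesis .
qed

text \<open>Chernoff's bound in counting form; the exponent \<open>l = t / s\<close> minimises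
  \<open>- l * t + l ^ 2 * s / 2\<close>.\<close>

lemma card_signs_sum_ge:
  fixes a :: "nat \<Rightarrow> real"
  assumes J: "finite J" and s: "s > 0" "(\<Sum>j\<in>J. (a j)\<^sup>2) = s" and t: "0 \<le> t"
  shows "real (card {\<epsilon>\<in>PiE J (\<lambda>_. {-1, 1}). t \<le> (\<Sum>j\<in>J. \<epsilon> j * a j)}) \<le> 2 ^ card J * exp (- t\<^sup>2 / (2 * s))"
proof -
  let ?E = "PiE J (\<lambda>_. {-1, 1::real})"
  define l where "l = t / s"
  have l: "0 \<le> l" using s t by (simp add: l_def)
  have fin: "finite ?E" using J by (intro finite_PiE) auto
  have "real (card {\<epsilon>\<in>?E. t \<le> (\<Sum>j\<in>J. \<epsilon> j * a j)}) = (\<Sum>\<epsilon>\<in>?E. if t \<le> (\<Sum>j\<in>J. \<epsilon> j * a j) then 1 else 0)"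
    using fin by (simp add: sum.If_cases Int_def)
  also have "\<dots> \<le> (\<Sum>\<epsilon>\<in>?E. exp (- l * t) * exp (\<Sum>j\<in>J. \<epsilon> j * (l * a j)))"
  proof (rule sum_mono)
    fix \<epsilon>
    have "1 \<le> exp (- l * t) * exp (\<Sum>j\<in>J. \<epsilon> j * (l * a j))" if "t \<le> (\<Sum>j\<in>J. \<epsilon> j * a j)"
    proof -
      have "l * t \<le> l * (\<Sum>j\<in>J. \<epsilon> j * a j)" using that l by (intro mult_left_mono)
      also have "\<dots> = (\<Sum>j\<in>J. \<epsilon> j * (l * a j))" by (simp add: sum_distrib_left algebra_simps)
      finally show ?thesis by (simp flip: exp_add)
    qed
    then show "(if t \<le> (\<Sum>j\<in>J. \<epsilon> j * a j) then 1 else 0) \<le> exp (- l * t) * exp (\<Sum>j\<in>J. \<epsilon> j * (l * a j))"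
      by auto
  qed
  also have "\<dots> = exp (- l * t) * (\<Sum>\<epsilon>\<in>?E. exp (\<Sum>j\<in>J. \<epsilon> j * (l * a j)))"
    by (simp add: sum_distrib_left)
  also have "\<dots> \<le> exp (- l * t) * (2 ^ card J * exp ((\<Sum>j\<in>J. (l * a j)\<^sup>2) / 2))"
    by (intro mult_left_mono sum_signs_exp_le[OF J]) auto
  also have "(\<Sum>j\<in>J. (l * a j)\<^sup>2) = l\<^sup>2 * s"
    by (simp add: power_mult_distrib sum_distrib_left[symmetric] s(2))
  also have "exp (- l * t) * (2 ^ card J * exp (l\<^sup>2 * s / 2)) = 2 ^ card J * exp (- l * t + l\<^sup>2 * s / 2)"
    unfolding exp_add by simp
  also have "- l * t + l\<^sup>2 * s / 2 = - t\<^sup>2 / (2 * s)"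
    using s(1) by (simp add: l_def power2_eq_square field_simps)
  finally show ?thesis .
qed

lemma card_signs_abs_sum_ge:
  fixes a :: "nat \<Rightarrow> real"
  assumes J: "finite J" and s: "s > 0" "(\<Sum>j\<in>J. (a j)\<^sup>2) = s" and t: "0 \<le> t"
  shows "real (card {\<epsilon>\<in>PiE J (\<lambda>_. {-1, 1}). t \<le> \<bar>\<Sum>j\<in>J. \<epsilon> j * a j\<bar>}) \<le> 2 ^ card J * (2 * exp (- t\<^sup>2 / (2 * s)))"
proof -
  let ?E = "PiE J (\<lambda>_. {-1, 1::real})"
  have fin: "finite ?E" using J by (intro finite_PiE) auto
  have "{\<epsilon>\<in>?E. t \<le> \<bar>\<Sum>j\<in>J. \<epsilon> j * a j\<bar>} \<subseteq>
      {\<epsilon>\<in>?E. t \<le> (\<Sum>j\<in>J. \<epsilon> j * a j)} \<union> {\<epsilon>\<in>?E. t \<le> (\<Sum>j\<in>J. \<epsilon> j * - a j)}"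
    by (auto simp: sum_negf abs_if split: if_splits)
  then have "card {\<epsilon>\<in>?E. t \<le> \<bar>\<Sum>j\<in>J. \<epsilon> j * a j\<bar>} \<le>
      card ({\<epsilon>\<in>?E. t \<le> (\<Sum>j\<in>J. \<epsilon> j * a j)} \<union> {\<epsilon>\<in>?E. t \<le> (\<Sum>j\<in>J. \<epsilon> j * - a j)})"
    using fin by (intro card_mono) auto
  also have "\<dots> \<le> card {\<epsilon>\<in>?E. t \<le> (\<Sum>j\<in>J. \<epsilon> j * a j)} + card {\<epsilon>\<in>?E. t \<le> (\<Sum>j\<in>J. \<epsilon> j * - a j)}"
    by (rule card_Un_le)
  finally have "real (card {\<epsilon>\<in>?E. t \<le> \<bar>\<Sum>j\<in>J. \<epsilon> j * a j\<bar>}) \<le>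
      real (card {\<epsilon>\<in>?E. t \<le> (\<Sum>j\<in>J. \<epsilon> j * a j)}) + real (card {\<epsilon>\<in>?E. t \<le> (\<Sum>j\<in>J. \<epsilon> j * - a j)})"
    by linarith
  then show ?thesis
    using card_signs_sum_ge[OF J s t] card_signs_sum_ge[OF J s(1) _ t, of "\<lambda>j. - a j"] s(2) by simp
qed

text \<open>\<open>frame_map w b\<close> turns into \<open>frame_map w b \<circ> T\<^sup>-\<^sup>1\<close> when \<open>w\<close> is rotated by \<open>T\<close>, so for a
  Haar frame \<open>w\<close> it is a random orthogonal map with right-invariant law.  Hence its image of any
  fixed orthonormal frame \<open>e\<close> has the law \<open>V\<close>.\<close>

lemma haar_frames_representation:
  fixes V W :: "(nat \<Rightarrow> real^'d) measure"
  assumes V: "haar_frames N V" and W: "haar_frames CARD('d) W"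
    and b: "orthonormal_frame CARD('d) b" and e: "orthonormal_frame N e" and N: "N \<le> CARD('d)"
    and A: "A \<in> sets (frame_space N)"
  shows "emeasure V A = emeasure W {w \<in> space W. act N (frame_map w b) e \<in> A}"
    "{w \<in> space W. act N (frame_map w b) e \<in> A} \<in> sets W"
proof -
  interpret V: prob_space V by (rule haar_prob[OF V])
  interpret W: prob_space W by (rule haar_prob[OF W])
  interpret P: pair_prob_space W V ..
  note [measurable] = haar_component_measurable[OF W] haar_component_measurable[OF V]
  note [measurable] = A
  define \<Phi> where "\<Phi> = (\<lambda>p :: (nat \<Rightarrow> real^'d) \<times> (nat \<Rightarrow> real^'d). act N (frame_map (fst p) b) (snd p))"
  have \<Phi> [measurable]: "\<Phi> \<in> (W \<Otimes>\<^sub>M V) \<rightarrow>\<^sub>M frame_space N"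
    unfolding \<Phi>_def act_def frame_map_def by (intro measurable_restrict) measurable
  have \<Phi>e [measurable]: "(\<lambda>w. act N (frame_map w b) e') \<in> W \<rightarrow>\<^sub>M frame_space N" for e'
    unfolding act_def frame_map_def by (intro measurable_restrict) measurable
  show Am: "{w \<in> space W. act N (frame_map w b) e \<in> A} \<in> sets W" by measurable
  define S where "S = \<Phi> -` A \<inter> space (W \<Otimes>\<^sub>M V)"
  have S: "S \<in> sets (W \<Otimes>\<^sub>M V)" unfolding S_def by measurable
  have "emeasure V A = (\<integral>\<^sup>+w. emeasure V A \<partial>W)" by (simp add: W.emeasure_space_1)
  \<comment> \<open>For almost every fixed \<open>w\<close> the map \<open>frame_map w b\<close> is
    orthogonal, so it preserves \<open>V\<close>.\<close>
  also have "\<dots> = (\<integral>\<^sup>+w. emeasure V (Pair w -` S) \<partial>W)"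
  proof (rule nn_integral_cong_AE)
    show "AE w in W. emeasure V A = emeasure V (Pair w -` S)"
      using haar_ae[OF W] AE_space
    proof eventually_elim
      case (elim w)
      have T: "orthogonal_transformation (frame_map w b)"
        by (rule orthogonal_transformation_frame_map[OF elim(1) b])
      have "emeasure V A = emeasure (distr V (frame_space N) (act N (frame_map w b))) A"
        unfolding haar_distr[OF V T] ..
      also have "\<dots> = emeasure V (act N (frame_map w b) -` A \<inter> space V)"
        using act_measurable[OF T] haar_measurable_iff[OF V] by (intro emeasure_distr A) blast
      also have "act N (frame_map w b) -` A \<inter> space V = Pair w -` S"
        using elim(2) by (auto simp: S_def \<Phi>_def space_pair_measure)
      finally show ?case .
    qed
  qed
  also have "\<dots> = emeasure (W \<Otimes>\<^sub>M V) S" by (rule V.emeasure_pair_measure_alt[OF S, symmetric])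
  also have "\<dots> = (\<integral>\<^sup>+v. emeasure W ((\<lambda>w. (w, v)) -` S) \<partial>V)" by (rule P.emeasure_pair_measure_alt2[OF S])
  \<comment> \<open>Now \<open>v\<close> is fixed. An orthogonal \<open>T\<close> taking
    \<open>v\<close> to \<open>e\<close> preserves the inner products that define
    \<open>frame_map\<close>, so rotating \<open>w\<close> by \<open>T\<close>, which leaves its law
    unchanged, trades \<open>v\<close> for \<open>e\<close>.\<close>
  also have "\<dots> = (\<integral>\<^sup>+v. emeasure W {w \<in> space W. act N (frame_map w b) e \<in> A} \<partial>V)"
  proof (rule nn_integral_cong_AE)
    show "AE v in V. emeasure W ((\<lambda>w. (w, v)) -` S) = emeasure W {w \<in> space W. act N (frame_map w b) e \<in> A}"
      using haar_ae[OF V] AE_space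
    proof eventually_elim
      case (elim v)
      obtain T where T: "orthogonal_transformation T" "\<And>i. i \<in> {1..N} \<Longrightarrow> T (v i) = e i"
        using orthogonal_transformation_between_frames[OF elim(1) e N] by blast
      let ?a = "act CARD('d) T"
      have eq: "act N (frame_map (?a w) b) e = act N (frame_map w b) v" for w
      proof -
        have "frame_map (?a w) b (e i) = frame_map w b (v i)" if "i \<in> {1..N}" for i
          unfolding frame_map_def using T(1) T(2)[OF that, symmetric]
          by (intro sum.cong) (auto simp: act_def orthogonal_transformation_def)
        then show ?thesis by (auto simp: act_def)
      qed
      have aW: "?a \<in> W \<rightarrow>\<^sub>M frame_space CARD('d)"
        using act_measurable[OF T(1)] haar_measurable_iff[OF W] by blast
      have "emeasure W {w \<in> space W. act N (frame_map w b) e \<in> A} =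
          emeasure (distr W (frame_space CARD('d)) ?a) {w \<in> space W. act N (frame_map w b) e \<in> A}"
        unfolding haar_distr[OF W T(1)] ..
      also have "\<dots> = emeasure W (?a -` {w \<in> space W. act N (frame_map w b) e \<in> A} \<inter> space W)"
        using Am haar_sets[OF W] by (intro emeasure_distr aW) simp
      also have "?a -` {w \<in> space W. act N (frame_map w b) e \<in> A} \<inter> space W = (\<lambda>w. (w, v)) -` S"
        using elim(2) measurable_space[OF aW] haar_space[OF W]
        by (auto simp: S_def \<Phi>_def space_pair_measure eq)
      finally show ?case by simp
    qed
  qed
  also have "\<dots> = emeasure W {w \<in> space W. act N (frame_map w b) e \<in> A}" by (simp add: V.emeasure_space_1)
  finally show "emeasure V A = emeasure W {w \<in> space W. act N (frame_map w b) e \<in> A}" .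
qed

text \<open>Put \<open>u\<close> right after the first \<open>k\<close> vectors, extend, then swap
  positions \<open>k + 1\<close> and \<open>i\<close>.\<close>

lemma orthonormal_frame_replace:
  fixes b :: "nat \<Rightarrow> real^'d"
  assumes b: "orthonormal_frame k b" and i: "k < i" "i \<le> N" and N: "N \<le> CARD('d)"
    and u: "norm u = 1" "\<And>j. j \<in> {1..k} \<Longrightarrow> b j \<bullet> u = 0"
  shows "\<exists>e. orthonormal_frame N e \<and> (\<forall>j\<in>{1..k}. e j = b j) \<and> e i = u"
proof -
  have "orthonormal_frame (Suc k) (b(Suc k := u))"
    using b u unfolding orthonormal_frame_def
    by (auto simp: inner_commute norm_eq_1 le_Suc_eq)
  then obtain e where e: "orthonormal_frame N e" "\<forall>j\<in>{1..Suc k}. e j = (b(Suc k := u)) j"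
    using extend_orthonormal_frame[of "Suc k" "b(Suc k := u)" N] i N by fastforce
  define \<tau> where "\<tau> = Transposition.transpose i (Suc k)"
  have \<tau>: "\<tau> j \<in> {1..N}" if "j \<in> {1..N}" for j
    using that i by (auto simp: \<tau>_def Transposition.transpose_def)
  have inj: "\<tau> j = \<tau> l \<longleftrightarrow> j = l" for j l by (auto simp: \<tau>_def Transposition.transpose_def)
  have "orthonormal_frame N (\<lambda>j. e (\<tau> j))"
    using orthonormal_frameD[OF e(1) \<tau> \<tau>] inj unfolding orthonormal_frame_def by simp
  moreover have "\<forall>j\<in>{1..k}. e (\<tau> j) = b j" using e(2) i by (auto simp: \<tau>_def Transposition.transpose_def)
  moreover have "e (\<tau> i) = u" using e(2) by (auto simp: \<tau>_def Transposition.transpose_def)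
  ultimately show ?thesis by (intro exI[of _ "\<lambda>j. e (\<tau> j)"]) simp
qed

text \<open>\<open>X\<close> stands for a query and \<open>A\<close> for frames where it correlates
  with \<open>v i\<close>; only within \<open>A\<close> must \<open>X\<close> be a function of
  \<open>v 1\<close>, ..., \<open>v k\<close>. The measure of \<open>A\<close> is an average over
  sign vectors of probabilities under one Haar basis \<open>w\<close>, and for each fixed
  \<open>w\<close> few signs lead into \<open>A\<close>.\<close>

lemma haar_frames_tail:
  fixes V :: "(nat \<Rightarrow> real^'d) measure" and X :: "(nat \<Rightarrow> real^'d) \<Rightarrow> real^'d"
  assumes V: "haar_frames N V" and N: "1 \<le> N" "N \<le> CARD('d)" and k: "k < i" "i \<le> N" and \<kappa>: "0 \<le> \<kappa>"
    and A: "A \<in> sets (frame_space N)"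
    and on: "\<And>v. v \<in> A \<Longrightarrow> orthonormal_frame N v"
    and X: "\<And>v v'. v \<in> A \<Longrightarrow> v' \<in> A \<Longrightarrow> (\<And>j. j \<in> {1..k} \<Longrightarrow> v j = v' j) \<Longrightarrow> X v = X v'"
    and nz: "\<And>v. v \<in> A \<Longrightarrow> frame_resid k v (X v) \<noteq> 0"
    and big: "\<And>v. v \<in> A \<Longrightarrow> \<kappa> * norm (frame_resid k v (X v)) \<le> \<bar>v i \<bullet> X v\<bar>"
  shows "measure V A \<le> 2 * exp (- \<kappa>\<^sup>2 * real (CARD('d) - k) / 2)"
proof -
  obtain W :: "(nat \<Rightarrow> real^'d) measure" where W: "haar_frames CARD('d) W"
    using haar_frames_full_exists[OF V N] by blast
  interpret W: prob_space W by (rule haar_prob[OF W])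
  obtain b :: "nat \<Rightarrow> real^'d" where b: "orthonormal_frame CARD('d) b"
    using extend_orthonormal_frame[of 0 _ "CARD('d)"] by (auto simp: orthonormal_frame_def)
  have bk: "orthonormal_frame k b" using orthonormal_frame_mono[OF b] k N by simp
  define J where "J = {k<..CARD('d)}"
  define m where "m = card J"
  define E where "E = PiE J (\<lambda>_. {-1, 1::real})"
  have m: "m = CARD('d) - k" "0 < m" using k N by (auto simp: m_def J_def)
  have J: "finite J" "J \<subseteq> {1..CARD('d)}" by (auto simp: J_def)
  have finE: "finite E" unfolding E_def using J by (intro finite_PiE) auto
  have cE: "card E = 2 ^ m" unfolding E_def m_def using J by (simp add: card_PiE numeral_2_eq_2)
  have sq: "(\<epsilon> j)\<^sup>2 = 1" if "\<epsilon> \<in> E" "j \<in> J" for \<epsilon> j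
    using that unfolding E_def by (auto dest: PiE_mem)
  \<comment> \<open>Scaling by the number \<open>m\<close> of signs makes this a unit vector; it is
    orthogonal to \<open>b 1\<close>, ..., \<open>b k\<close> and so may serve as
    \<open>i\<close>-th vector.\<close>
  define u where "u \<epsilon> = (\<Sum>j\<in>J. (\<epsilon> j / sqrt (real m)) *\<^sub>R b j)" for \<epsilon>
  have bu: "b j \<bullet> u \<epsilon> = (if j \<in> J then \<epsilon> j / sqrt (real m) else 0)" if "j \<in> {1..CARD('d)}" for \<epsilon> j
    unfolding u_def by (rule inner_frame_sum[OF b that J(2)])
  have nu: "norm (u \<epsilon>) = 1" if "\<epsilon> \<in> E" for \<epsilon>
  proof -
    have "u \<epsilon> \<bullet> u \<epsilon> = (\<Sum>j\<in>J. (\<epsilon> j / sqrt (real m)) * (b j \<bullet> u \<epsilon>))"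
      by (subst (1) u_def) (simp add: inner_sum_left)
    also have "\<dots> = (\<Sum>j\<in>J. 1 / real m)"
      using bu J(2) sq[OF that] m by (intro sum.cong) (auto simp: subset_iff power2_eq_square)
    also have "\<dots> = 1" using m by (simp add: m_def)
    finally show ?thesis by (simp add: norm_eq_1)
  qed
  have "\<exists>e. orthonormal_frame N e \<and> (\<forall>j\<in>{1..k}. e j = b j) \<and> e i = u \<epsilon>" if "\<epsilon> \<in> E" for \<epsilon>
    using bu k N nu[OF that] by (intro orthonormal_frame_replace[OF bk k N(2)]) (auto simp: J_def)
  then obtain e where e: "\<And>\<epsilon>. \<epsilon> \<in> E \<Longrightarrow> orthonormal_frame N (e \<epsilon>)"
    "\<And>\<epsilon> j. \<epsilon> \<in> E \<Longrightarrow> j \<in> {1..k} \<Longrightarrow> e \<epsilon> j = b j" "\<And>\<epsilon>. \<epsilon> \<in> E \<Longrightarrow> e \<epsilon> i = u \<epsilon>"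
    by metis
  define S where "S \<epsilon> = {w \<in> space W. act N (frame_map w b) (e \<epsilon>) \<in> A}" for \<epsilon>
  have S: "S \<epsilon> \<in> sets W" "measure V A = W.prob (S \<epsilon>)" if "\<epsilon> \<in> E" for \<epsilon>
    using haar_frames_representation[OF V W b e(1)[OF that] N(2) A] by (auto simp: S_def measure_def)
  let ?p = "2 * exp (- \<kappa>\<^sup>2 * real m / 2)"
  have count: "real (card {\<epsilon>\<in>E. w \<in> S \<epsilon>}) \<le> 2 ^ m * ?p" if w: "orthonormal_frame CARD('d) w" for w
  proof (cases "{\<epsilon>\<in>E. w \<in> S \<epsilon>} = {}")
    case True
    then show ?thesis unfolding True by simp
  next
    case False
    then obtain \<epsilon>0 where \<epsilon>0: "\<epsilon>0 \<in> E" "w \<in> S \<epsilon>0" by blast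
    let ?g = "frame_map w b"
    let ?v = "\<lambda>\<epsilon>. act N ?g (e \<epsilon>)"
    have T: "orthogonal_transformation ?g" by (rule orthogonal_transformation_frame_map[OF w b])
    define c where "c j = ?g (b j)" for j
    have c: "orthonormal_frame CARD('d) c" unfolding c_def by (rule orthonormal_frame_image[OF T b])
    have ck: "orthonormal_frame k c" using orthonormal_frame_mono[OF c] k N by simp
    have v_low: "?v \<epsilon> j = c j" if "\<epsilon> \<in> E" "j \<in> {1..k}" for \<epsilon> j
      using that e(2) k by (simp add: act_def c_def)
    have v_i: "?v \<epsilon> i = (\<Sum>j\<in>J. (\<epsilon> j / sqrt (real m)) *\<^sub>R c j)" if "\<epsilon> \<in> E" for \<epsilon>
      using that e(3)[OF that] k orthogonal_transformation_linear[OF T]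
      by (simp add: act_def u_def c_def linear_sum linear_cmul)
    define x where "x = X (?v \<epsilon>0)"
    define z where "z = frame_resid k c x"
    \<comment> \<open>The frames in question lie in \<open>A\<close> and share their first
      \<open>k\<close> vectors, so they all give the same query. The signs are therefore tested
      against a fixed vector.\<close>
    have Xx: "X (?v \<epsilon>) = x" if "\<epsilon> \<in> E" "w \<in> S \<epsilon>" for \<epsilon>
      unfolding x_def using that \<epsilon>0 v_low by (intro X) (auto simp: S_def)
    have rz: "frame_resid k (?v \<epsilon>) x = z" if "\<epsilon> \<in> E" for \<epsilon>
      unfolding z_def using v_low[OF that] by (intro frame_resid_cong) auto
    have z0: "norm z > 0"
      using nz[of "?v \<epsilon>0"] \<epsilon>0 Xx[OF \<epsilon>0] rz[OF \<epsilon>0(1)] by (simp add: S_def)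
    define a where "a j = c j \<bullet> x" for j
    have az: "a j = c j \<bullet> z" if "j \<in> J" for j
      using inner_frame_resid_high[OF c, of j k x] that by (simp add: a_def z_def J_def)
    \<comment> \<open>In the basis \<open>c\<close> the residual has coordinates with index above
      \<open>k\<close> only, so the coefficients \<open>a j\<close> of the sign sum carry its whole
      squared norm.\<close>
    have "(norm z)\<^sup>2 = (\<Sum>j\<in>{1..CARD('d)}. (c j \<bullet> z)\<^sup>2) + (norm (frame_resid CARD('d) c z))\<^sup>2"
      by (rule norm_frame_decomp[OF c])
    also have "frame_resid CARD('d) c z = 0"
      using sum_scaleR_orthonormal_basis[OF c, of z] by (simp add: frame_resid_def)
    also have "(\<Sum>j\<in>{1..CARD('d)}. (c j \<bullet> z)\<^sup>2) = (\<Sum>j\<in>J. (c j \<bullet> z)\<^sup>2)"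
      using inner_frame_resid_low[OF ck, of _ x] J
      by (intro sum.mono_neutral_right) (auto simp: z_def J_def)
    finally have asum: "(\<Sum>j\<in>J. (a j)\<^sup>2) = (norm z)\<^sup>2" using az by simp
    let ?t = "\<kappa> * sqrt (real m) * norm z"
    have sub: "{\<epsilon>\<in>E. w \<in> S \<epsilon>} \<subseteq> {\<epsilon>\<in>E. ?t \<le> \<bar>\<Sum>j\<in>J. \<epsilon> j * a j\<bar>}"
    proof (clarsimp)
      fix \<epsilon> assume \<epsilon>: "\<epsilon> \<in> E" "w \<in> S \<epsilon>"
      then have "?v \<epsilon> \<in> A" by (simp add: S_def)
      then have 1: "\<kappa> * norm z \<le> \<bar>?v \<epsilon> i \<bullet> x\<bar>"
        using big[of "?v \<epsilon>"] Xx[OF \<epsilon>] rz[OF \<epsilon>(1)] by simp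
      have "?v \<epsilon> i \<bullet> x = (\<Sum>j\<in>J. \<epsilon> j * a j) / sqrt (real m)"
        unfolding v_i[OF \<epsilon>(1)] by (simp add: inner_sum_left a_def sum_divide_distrib)
      then have "\<bar>?v \<epsilon> i \<bullet> x\<bar> * sqrt (real m) = \<bar>\<Sum>j\<in>J. \<epsilon> j * a j\<bar>"
        using m by simp
      moreover have "\<kappa> * norm z * sqrt (real m) \<le> \<bar>?v \<epsilon> i \<bullet> x\<bar> * sqrt (real m)"
        using 1 by (intro mult_right_mono) auto
      ultimately show "?t \<le> \<bar>\<Sum>j\<in>J. \<epsilon> j * a j\<bar>" by (simp add: mult_ac)
    qed
    have "real (card {\<epsilon>\<in>E. w \<in> S \<epsilon>}) \<le> real (card {\<epsilon>\<in>E. ?t \<le> \<bar>\<Sum>j\<in>J. \<epsilon> j * a j\<bar>})"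
      using card_mono[OF _ sub] finE by simp
    also have "\<dots> \<le> 2 ^ card J * (2 * exp (- ?t\<^sup>2 / (2 * (norm z)\<^sup>2)))"
      unfolding E_def using z0 \<kappa> by (intro card_signs_abs_sum_ge[OF J(1) _ asum]) auto
    also have "- ?t\<^sup>2 / (2 * (norm z)\<^sup>2) = - \<kappa>\<^sup>2 * real m / 2"
      using z0 by (simp add: power_mult_distrib)
    finally show ?thesis by (simp add: m_def)
  qed
  \<comment> \<open>Double counting: each sign vector contributes the same probability, and the
    number of signs leading into \<open>A\<close> is bounded at almost every
    \<open>w\<close>.\<close>
  have "2 ^ m * measure V A = (\<Sum>\<epsilon>\<in>E. measure V A)"
    using cE by simp
  also have "\<dots> = (\<Sum>\<epsilon>\<in>E. W.prob (S \<epsilon>))"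
    by (rule sum.cong[OF refl S(2)])
  also have "\<dots> = (\<Sum>\<epsilon>\<in>E. W.expectation (indicator (S \<epsilon>)))"
    using S(1) by (intro sum.cong) auto
  also have "\<dots> = W.expectation (\<lambda>w. \<Sum>\<epsilon>\<in>E. indicator (S \<epsilon>) w)"
    using S(1) by (intro Bochner_Integration.integral_sum[symmetric])
      (simp add: integrable_indicator_iff W.emeasure_eq_measure)
  also have "\<dots> \<le> W.expectation (\<lambda>w. 2 ^ m * ?p)"
  proof (rule integral_mono_AE)
    show "integrable W (\<lambda>w. \<Sum>\<epsilon>\<in>E. indicator (S \<epsilon>) w :: real)"
      using S(1) by (intro Bochner_Integration.integrable_sum)
        (simp add: integrable_indicator_iff W.emeasure_eq_measure)
    show "AE w in W. (\<Sum>\<epsilon>\<in>E. indicator (S \<epsilon>) w) \<le> 2 ^ m * ?p"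
      using haar_ae[OF W]
    proof eventually_elim
      case (elim w)
      have "(\<Sum>\<epsilon>\<in>E. indicator (S \<epsilon>) w :: real) = card {\<epsilon>\<in>E. w \<in> S \<epsilon>}"
        using finE by (simp add: indicator_def sum.If_cases Int_def)
      then show ?case using count[OF elim] by simp
    qed
  qed simp
  finally have "2 ^ m * measure V A \<le> 2 ^ m * ?p" by (simp add: W.prob_space)
  then have "measure V A \<le> ?p" by (simp only: mult_le_cancel_left_pos zero_less_power zero_less_numeral)
  then show ?thesis by (simp add: m)
qed

section \<open>Measurability of the interaction\<close>

text \<open>The supremum runs over an uncountable set that varies with the frame. Since the
  complement of the closed cones is described by strict inequalities and the terms are continuous
  off the origin, a countable dense subset \<open>D\<close> of the shell detects every strict lower
  bound.\<close>

lemma wall_measurable: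
  assumes par: "0 < \<delta>" "0 \<le> \<alpha>"
  shows "(\<lambda>p. wall \<kappa> \<delta> \<alpha> N (fst p) (snd p)) \<in> borel_measurable (frame_space N \<Otimes>\<^sub>M (borel :: (real^'d) measure))"
proof -
  let ?M = "frame_space N \<Otimes>\<^sub>M (borel :: (real^'d) measure)"
  define K :: "(real^'d) set" where "K = {y. \<delta> \<le> norm y \<and> norm y \<le> 1}"
  obtain D where D: "countable D" "D \<subseteq> K" "K \<subseteq> closure D" using separable[of K] by blast
  define Q where "Q v y \<longleftrightarrow> (\<forall>i\<in>{1..N}. \<bar>v i \<bullet> y\<bar> < \<kappa> * norm y)" for v :: "nat \<Rightarrow> real^'d" and y
  have shield: "y \<in> shield_dom \<kappa> \<delta> N v \<longleftrightarrow> y \<in> K \<and> Q v y" for v y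
    unfolding shield_dom_iff[OF par(1)] K_def Q_def by auto
  have Qopen: "open {y. Q v y}" for v
  proof -
    have "{y. Q v y} = (\<Inter>i\<in>{1..N}. {y. \<bar>v i \<bullet> y\<bar> < \<kappa> * norm y})" by (auto simp: Q_def)
    then show ?thesis by (auto intro!: open_INT open_Collect_less continuous_intros)
  qed
  have dense: "\<exists>y\<in>D. y \<in> U" if "open U" "y \<in> K" "y \<in> U" for U y
    using open_Int_closure_eq_empty[OF that(1), of D] that D(3) by blast
  have topen: "open ((- {0}) \<inter> (\<lambda>y. wall_term \<alpha> y x) -` {a<..})" for x :: "real^'d" and a
    unfolding wall_term_def hfun_def hgrad_def
    by (rule continuous_open_preimage) (auto intro!: continuous_intros)
  have zero: "0 \<notin> K" using par by (simp add: K_def)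
  have ex: "(\<exists>y\<in>shield_dom \<kappa> \<delta> N v. a < wall_term \<alpha> y x) \<longleftrightarrow> (\<exists>y\<in>D. Q v y \<and> a < wall_term \<alpha> y x)"
    for v x a
  proof
    assume "\<exists>y\<in>shield_dom \<kappa> \<delta> N v. a < wall_term \<alpha> y x"
    then obtain y where y: "y \<in> K" "Q v y" "a < wall_term \<alpha> y x" by (auto simp: shield)
    have "open ({y. Q v y} \<inter> ((- {0}) \<inter> (\<lambda>y. wall_term \<alpha> y x) -` {a<..}))"
      by (intro open_Int Qopen topen)
    from dense[OF this y(1)] y zero show "\<exists>y\<in>D. Q v y \<and> a < wall_term \<alpha> y x" by auto
  next
    assume "\<exists>y\<in>D. Q v y \<and> a < wall_term \<alpha> y x"
    then show "\<exists>y\<in>shield_dom \<kappa> \<delta> N v. a < wall_term \<alpha> y x"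
      using D(2) unfolding Bex_def shield by blast
  qed
  have empty: "shield_dom \<kappa> \<delta> N v = {} \<longleftrightarrow> (\<forall>y\<in>D. \<not> Q v y)" for v
    using dense[OF Qopen] D(2) by (auto simp: shield set_eq_iff)
  have Qm: "{p \<in> space ?M. Q (fst p) y} \<in> sets ?M" for y
    unfolding Q_def by measurable
  have tm: "{p \<in> space ?M. a < wall_term \<alpha> y (snd p)} \<in> sets ?M" for y a
    unfolding wall_term_def by measurable
  have "{p \<in> space ?M. a < wall \<kappa> \<delta> \<alpha> N (fst p) (snd p)} \<in> sets ?M" for a
  proof -
    \<comment> \<open>The second alternative covers an empty domain, where the wall is the constant
      \<open>Sup {}\<close>.\<close>
    have "a < wall \<kappa> \<delta> \<alpha> N v x \<longleftrightarrow> (\<exists>y\<in>D. Q v y \<and> a < wall_term \<alpha> y x) \<or>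
        ((\<forall>y\<in>D. \<not> Q v y) \<and> a < Sup {})" for v x
    proof (cases "shield_dom \<kappa> \<delta> N v = {}")
      case True
      then show ?thesis using empty[of v] by (auto simp: wall_eq_SUP)
    next
      case False
      then show ?thesis
        using less_cSUP_iff[OF False bdd_above_wall_term[OF par], of a x] empty[of v] ex[of v a x]
        by (auto simp: wall_eq_SUP)
    qed
    then have eq: "{p \<in> space ?M. a < wall \<kappa> \<delta> \<alpha> N (fst p) (snd p)} =
      (\<Union>y\<in>D. {p \<in> space ?M. Q (fst p) y} \<inter> {p \<in> space ?M. a < wall_term \<alpha> y (snd p)}) \<union>
      ((space ?M - (\<Union>y\<in>D. {p \<in> space ?M. Q (fst p) y})) \<inter> {p \<in> space ?M. a < Sup {}})"
      by auto
    show ?thesis unfolding eq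
      by (intro sets.Un sets.Int sets.Diff sets.countable_UN'' D(1) Qm tm sets.top) measurable
  qed
  then show ?thesis by (simp add: borel_measurable_iff_greater)
qed

lemma shielded_nemirovski_measurable:
  assumes "0 < \<delta>" "0 \<le> \<alpha>"
  shows "(\<lambda>p. shielded_nemirovski \<kappa> \<gamma> \<delta> \<alpha> N (fst p) (snd p)) \<in>
    borel_measurable (frame_space N \<Otimes>\<^sub>M (borel :: (real^'d) measure))"
  unfolding shielded_nemirovski_def nemirovski_def
  by (intro borel_measurable_max wall_measurable[OF assms] borel_measurable_Max) measurable

text \<open>Induction on the rounds. Histories are functions on countable index sets, so their
  measurability can be checked entry by entry.\<close>

lemma transcript_measurable:
  fixes cnt :: "nat \<Rightarrow> 'r \<Rightarrow> (real^'d) history \<Rightarrow> nat"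
    and qry :: "nat \<Rightarrow> 'r \<Rightarrow> (real^'d) history \<Rightarrow> nat \<Rightarrow> real^'d"
    and F :: "'v \<Rightarrow> real^'d \<Rightarrow> real" and G :: "'v \<Rightarrow> real^'d \<Rightarrow> real^'d"
  assumes cnt: "\<And>k. (\<lambda>(r, H). cnt k r H) \<in> measurable (R \<Otimes>\<^sub>M borel) (count_space UNIV)"
    and qry: "\<And>k q. (\<lambda>(r, H). qry k r H q) \<in> borel_measurable (R \<Otimes>\<^sub>M borel)"
    and F: "(\<lambda>p. F (fst p) (snd p)) \<in> borel_measurable (V \<Otimes>\<^sub>M borel)"
    and G: "(\<lambda>p. G (fst p) (snd p)) \<in> borel_measurable (V \<Otimes>\<^sub>M borel)"
  shows "(\<lambda>p. transcript cnt qry (F (fst p)) (G (fst p)) (snd p) k) \<in> borel_measurable (V \<Otimes>\<^sub>M R)"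
    and "(\<lambda>p. cnt k (snd p) (transcript cnt qry (F (fst p)) (G (fst p)) (snd p) k)) \<in>
      measurable (V \<Otimes>\<^sub>M R) (count_space UNIV)"
    and "(\<lambda>p. qry k (snd p) (transcript cnt qry (F (fst p)) (G (fst p)) (snd p) k) q) \<in>
      borel_measurable (V \<Otimes>\<^sub>M R)"
proof -
  define H where "H k p = transcript cnt qry (F (fst p)) (G (fst p)) (snd p) k" for k p
  have c: "(\<lambda>p. cnt k (snd p) (H k p)) \<in> measurable (V \<Otimes>\<^sub>M R) (count_space UNIV)"
    if "H k \<in> borel_measurable (V \<Otimes>\<^sub>M R)" for k
  proof -
    have "(\<lambda>p. (snd p, H k p)) \<in> (V \<Otimes>\<^sub>M R) \<rightarrow>\<^sub>M (R \<Otimes>\<^sub>M borel)" using that by measurable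
    from measurable_compose[OF this cnt[of k]] show ?thesis by simp
  qed
  have x: "(\<lambda>p. qry k (snd p) (H k p) q) \<in> borel_measurable (V \<Otimes>\<^sub>M R)"
    if "H k \<in> borel_measurable (V \<Otimes>\<^sub>M R)" for k q
  proof -
    have "(\<lambda>p. (snd p, H k p)) \<in> (V \<Otimes>\<^sub>M R) \<rightarrow>\<^sub>M (R \<Otimes>\<^sub>M borel)" using that by measurable
    from measurable_compose[OF this qry[of k q]] show ?thesis by simp
  qed
  have H: "H k \<in> borel_measurable (V \<Otimes>\<^sub>M R)" for k
  proof (induction k)
    case 0
    show ?case unfolding H_def by simp
  next
    case (Suc k)
    note [measurable] = Suc c[OF Suc] x[OF Suc]
    have y: "(\<lambda>p. (fst p, qry k (snd p) (H k p) q)) \<in> (V \<Otimes>\<^sub>M R) \<rightarrow>\<^sub>M (V \<Otimes>\<^sub>M borel)" for q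
      by measurable
    have [measurable]: "(\<lambda>p. F (fst p) (qry k (snd p) (H k p) q)) \<in> borel_measurable (V \<Otimes>\<^sub>M R)" for q
      using measurable_compose[OF y F] by simp
    have [measurable]: "(\<lambda>p. G (fst p) (qry k (snd p) (H k p) q)) \<in> borel_measurable (V \<Otimes>\<^sub>M R)" for q
      using measurable_compose[OF y G] by simp
    have Hjq [measurable]: "(\<lambda>p. H k p j q) \<in> borel_measurable (V \<Otimes>\<^sub>M R)" for j q
      by (rule measurable_product_then_coordinatewise[OF measurable_product_then_coordinatewise[OF Suc]])
    have "H (Suc k) = (\<lambda>p j q. if j < k then H k p j q
        else if j = k \<and> q < cnt k (snd p) (H k p)
          then (F (fst p) (qry k (snd p) (H k p) q), G (fst p) (qry k (snd p) (H k p) q)) else (0, 0))"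
      by (auto simp: H_def Let_def fun_eq_iff)
    moreover have "\<dots> \<in> borel_measurable (V \<Otimes>\<^sub>M R)"
    proof (intro measurable_coordinatewise_then_product)
      fix j q
      show "(\<lambda>p. if j < k then H k p j q
        else if j = k \<and> q < cnt k (snd p) (H k p)
          then (F (fst p) (qry k (snd p) (H k p) q), G (fst p) (qry k (snd p) (H k p) q)) else (0, 0))
        \<in> borel_measurable (V \<Otimes>\<^sub>M R)"
      proof (cases "j < k")
        case True
        then show ?thesis using Hjq[of j q] by simp
      next
        case False
        have "(\<lambda>p. (F (fst p) (qry k (snd p) (H k p) q), G (fst p) (qry k (snd p) (H k p) q)))
          \<in> borel_measurable (V \<Otimes>\<^sub>M R)"
          by (intro borel_measurable_Pair) measurable
        then show ?thesis using False by (auto intro!: measurable_If)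
      qed
    qed
    ultimately show ?case by simp
  qed
  show "(\<lambda>p. transcript cnt qry (F (fst p)) (G (fst p)) (snd p) k) \<in> borel_measurable (V \<Otimes>\<^sub>M R)"
    using H[of k] by (simp add: H_def[abs_def])
  show "(\<lambda>p. cnt k (snd p) (transcript cnt qry (F (fst p)) (G (fst p)) (snd p) k)) \<in>
      measurable (V \<Otimes>\<^sub>M R) (count_space UNIV)"
    using c[OF H, of k] by (simp add: H_def)
  show "(\<lambda>p. qry k (snd p) (transcript cnt qry (F (fst p)) (G (fst p)) (snd p) k) q) \<in>
      borel_measurable (V \<Otimes>\<^sub>M R)"
    using x[OF H, of k q] by (simp add: H_def)
qed

text \<open>The hypothesis may presuppose equal histories before round \<open>j\<close>, so only
  answers at points actually asked have to be compared.\<close>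

lemma transcript_cong:
  assumes "\<And>j q. j < k \<Longrightarrow> q < cnt j r (transcript cnt qry F G r j) \<Longrightarrow>
      transcript cnt qry F G r j = transcript cnt qry F' G' r j \<Longrightarrow>
      F (qry j r (transcript cnt qry F G r j) q) = F' (qry j r (transcript cnt qry F G r j) q) \<and>
      G (qry j r (transcript cnt qry F G r j) q) = G' (qry j r (transcript cnt qry F G r j) q)"
  shows "transcript cnt qry F G r k = transcript cnt qry F' G' r k"
  using assms
proof (induction k)
  case (Suc k)
  then have "transcript cnt qry F G r k = transcript cnt qry F' G' r k" by simp
  with Suc.prems[of k] show ?case by (intro ext) (simp add: Let_def)
qed simp

section \<open>The lower bound\<close>

text \<open>The answers of round \<open>j\<close> involve \<open>v 1\<close>, ...,
  \<open>v (Suc j)\<close> only, and \<open>Suc j \<le> k\<close>. Goodness is assumed for both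
  frames because the local form of the function is applied to each of them.\<close>

lemma transcript_determined:
  fixes v v' :: "nat \<Rightarrow> real^'d"
    and cnt :: "nat \<Rightarrow> 'r \<Rightarrow> (real^'d) history \<Rightarrow> nat"
    and qry :: "nat \<Rightarrow> 'r \<Rightarrow> (real^'d) history \<Rightarrow> nat \<Rightarrow> real^'d"
    and sg :: "(nat \<Rightarrow> real^'d) \<Rightarrow> real^'d \<Rightarrow> real^'d" and \<kappa> \<delta> \<alpha> :: real and N :: nat
  defines "f \<equiv> shielded_nemirovski \<kappa> (2 * \<delta> * \<kappa>) \<delta> \<alpha> N"
  assumes on: "orthonormal_frame N v" "orthonormal_frame N v'" and k: "k \<le> N" "N < CARD('d)"
    and par: "0 < \<delta>" "\<delta> < 1" "0 < \<kappa>" "\<kappa> \<le> 1" "0 \<le> \<alpha>" "\<delta> powr \<alpha> = 1 / 2"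
    and pos: "real N * (2 * \<delta> * \<kappa>) < \<alpha> * \<delta> - (1 + \<alpha>) * sqrt (real N) * \<kappa>"
    and agree: "\<And>j. j \<in> {1..k} \<Longrightarrow> v j = v' j"
    and ball: "\<And>k r H q. q < cnt k r H \<Longrightarrow> norm (qry k r H q) \<le> 1"
    and local: "\<And>v v' x e. orthonormal_frame N v \<Longrightarrow> orthonormal_frame N v' \<Longrightarrow> e > 0 \<Longrightarrow>
                     (\<forall>y\<in>ball x e. f v y = f v' y) \<Longrightarrow> sg v x = sg v' x"
    and good: "\<And>j q. j < k \<Longrightarrow> q < cnt j r (transcript cnt qry (f v) (sg v) r j) \<Longrightarrow>
      uncorrelated \<kappa> N j v (qry j r (transcript cnt qry (f v) (sg v) r j) q)"
    and good': "\<And>j q. j < k \<Longrightarrow> q < cnt j r (transcript cnt qry (f v') (sg v') r j) \<Longrightarrow>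
      uncorrelated \<kappa> N j v' (qry j r (transcript cnt qry (f v') (sg v') r j) q)"
  shows "transcript cnt qry (f v) (sg v) r k = transcript cnt qry (f v') (sg v') r k"
proof (rule transcript_cong)
  fix j q
  define H where "H = transcript cnt qry (f v) (sg v) r j"
  define x where "x = qry j r H q"
  assume j: "j < k" and "q < cnt j r (transcript cnt qry (f v) (sg v) r j)"
    and "transcript cnt qry (f v) (sg v) r j = transcript cnt qry (f v') (sg v') r j"
  then have q: "q < cnt j r H" and H': "transcript cnt qry (f v') (sg v') r j = H"
    by (auto simp: H_def)
  have x1: "norm x \<le> 1" unfolding x_def by (rule ball[OF q])
  have u: "uncorrelated \<kappa> N j v x" using good[OF j] q by (simp add: H_def x_def)
  have u': "uncorrelated \<kappa> N j v' x" using good'[OF j] q unfolding H' by (simp add: x_def)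
  have jN: "j < N" using j k by simp
  obtain e1 where e1: "e1 > 0" "\<And>y. y \<in> ball x e1 \<Longrightarrow>
      f v y = max (nemirovski (2 * \<delta> * \<kappa>) (Suc j) v y) (wall \<kappa> \<delta> \<alpha> j v y)"
    using shielded_nemirovski_local[OF on(1) jN k(2) par pos x1 u] unfolding f_def by blast
  obtain e2 where e2: "e2 > 0" "\<And>y. y \<in> ball x e2 \<Longrightarrow>
      f v' y = max (nemirovski (2 * \<delta> * \<kappa>) (Suc j) v' y) (wall \<kappa> \<delta> \<alpha> j v' y)"
    using shielded_nemirovski_local[OF on(2) jN k(2) par pos x1 u'] unfolding f_def by blast
  have "nemirovski (2 * \<delta> * \<kappa>) (Suc j) v y = nemirovski (2 * \<delta> * \<kappa>) (Suc j) v' y"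
    "wall \<kappa> \<delta> \<alpha> j v y = wall \<kappa> \<delta> \<alpha> j v' y" for y
    using agree j by (auto intro!: nemirovski_cong wall_cong)
  then have eq: "\<forall>y\<in>ball x (min e1 e2). f v y = f v' y" using e1(2) e2(2) by simp
  then have "sg v x = sg v' x" using e1(1) e2(1) by (intro local[OF on, of "min e1 e2"]) auto
  moreover have "f v x = f v' x" using eq e1(1) e2(1) by simp
  ultimately show "f v (qry j r (transcript cnt qry (f v) (sg v) r j) q) =
      f v' (qry j r (transcript cnt qry (f v) (sg v) r j) q) \<and>
    sg v (qry j r (transcript cnt qry (f v) (sg v) r j) q) =
      sg v' (qry j r (transcript cnt qry (f v) (sg v) r j) q)"
    by (simp add: H_def x_def)
qed

text \<open>By Fubini a bound uniform in \<open>y\<close> passes to the product. With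
  \<open>y\<close> as internal randomness, this reduces the estimates to deterministic
  algorithms.\<close>

lemma (in pair_prob_space) measure_pair_le:
  assumes A: "A \<in> sets (M1 \<Otimes>\<^sub>M M2)" and p: "0 \<le> p"
    and le: "\<And>y. y \<in> space M2 \<Longrightarrow> measure M1 ((\<lambda>x. (x, y)) -` A) \<le> p"
  shows "measure (M1 \<Otimes>\<^sub>M M2) A \<le> p"
proof -
  have "emeasure (M1 \<Otimes>\<^sub>M M2) A = (\<integral>\<^sup>+y. emeasure M1 ((\<lambda>x. (x, y)) -` A) \<partial>M2)"
    by (rule emeasure_pair_measure_alt2[OF A])
  also have "\<dots> \<le> (\<integral>\<^sup>+y. ennreal p \<partial>M2)"
    using le by (intro nn_integral_mono) (simp add: M1.emeasure_eq_measure ennreal_leI)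
  also have "\<dots> = ennreal p" by (simp add: M2.emeasure_space_1)
  finally show ?thesis using p by (simp add: emeasure_eq_measure)
qed

theorem mainTheorem1:
  fixes V :: "(nat \<Rightarrow> real^'d) measure"
    and R :: "'r measure"
    and Q N T :: nat
    and \<rho> C \<kappa> \<delta> \<alpha> \<gamma> :: real
    and cnt :: "nat \<Rightarrow> 'r \<Rightarrow> (real^'d) history \<Rightarrow> nat"
    and qry :: "nat \<Rightarrow> 'r \<Rightarrow> (real^'d) history \<Rightarrow> nat \<Rightarrow> real^'d"
    and sg :: "(nat \<Rightarrow> real^'d) \<Rightarrow> real^'d \<Rightarrow> real^'d"
  defines "d \<equiv> CARD('d)"
  defines "f \<equiv> shielded_nemirovski \<kappa> \<gamma> \<delta> \<alpha> N"
  assumes d_ge: "d \<ge> 2"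
    and Q_ge: "Q \<ge> 1"
    and rho: "0 < \<rho>" "\<rho> < 1"
    and C_def: "C = 12 + 4 * log (real d) (real Q / \<rho>)"
    and N_ge: "2 \<le> N" and N_le: "real N \<le> real d / 2"
    and N_cond: "ln (real N) * real N * sqrt (C * ln (real d) / real d) \<le> 1 / 4"
    and kappa_def: "\<kappa> = sqrt (C * ln (real d) / real d)"
    and delta: "0 < \<delta>" "\<delta> < 1"
      "\<delta> / log 2 (1 / \<delta>) = 4 * sqrt (C * real N * ln (real d) / real d) + 1 / sqrt (real N)"
    and alpha_def: "\<alpha> = 1 / log 2 (1 / \<delta>)"
    and gamma_def: "\<gamma> = 2 * \<delta> * \<kappa>"
    \<comment> \<open>\<open>v_1,...,v_N\<close> Haar-distributed orthonormal family\<close>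
    and haar: "haar_frames N V"
    \<comment> \<open>internal randomness of the algorithm\<close>
    and R_prob: "prob_space R"
    \<comment> \<open>the algorithm: at most N rounds, at most Q queries per round, all in the unit ball,
        measurable in (randomness, history)\<close>
    and T_le: "T \<le> N"
    and cnt_le: "\<And>k r H. cnt k r H \<le> Q"
    and qry_ball: "\<And>k r H q. q < cnt k r H \<Longrightarrow> norm (qry k r H q) \<le> 1"
    and cnt_meas: "\<And>k. (\<lambda>(r, H). cnt k r H) \<in> measurable (R \<Otimes>\<^sub>M borel) (count_space UNIV)"
    and qry_meas: "\<And>k q. (\<lambda>(r, H). qry k r H q) \<in> borel_measurable (R \<Otimes>\<^sub>M borel)"
    \<comment> \<open>the first-order oracle: returns a subgradient of f, locally determined, measurable\<close>
    and sg_subgrad: "\<And>v x y. orthonormal_frame N v \<Longrightarrow> f v y \<ge> f v x + sg v x \<bullet> (y - x)"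
    and sg_local: "\<And>v v' x e. orthonormal_frame N v \<Longrightarrow> orthonormal_frame N v' \<Longrightarrow> e > 0 \<Longrightarrow>
                     (\<forall>y\<in>ball x e. f v y = f v' y) \<Longrightarrow> sg v x = sg v' x"
    and sg_meas: "(\<lambda>(v, x). sg v x) \<in> borel_measurable (V \<Otimes>\<^sub>M borel)"
  shows "\<exists>B \<in> sets (V \<Otimes>\<^sub>M R).
           measure (V \<Otimes>\<^sub>M R) B \<le> \<rho> \<and>
           (\<forall>(v, r) \<in> space (V \<Otimes>\<^sub>M R) - B.
              \<forall>k < T. \<forall>q < cnt k r (transcript cnt qry (f v) (sg v) r k).
                f v (qry k r (transcript cnt qry (f v) (sg v) r k) q)
                  - (INF z\<in>cball 0 1. f v z) \<ge> 1 / (4 * sqrt (real N)))"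
proof -
  define D where "D = \<alpha> * \<delta> - (1 + \<alpha>) * sqrt (real N) * \<kappa>"
  have f_eq: "f = shielded_nemirovski \<kappa> (2 * \<delta> * \<kappa>) \<delta> \<alpha> N" unfolding f_def gamma_def ..
  have dd: "real N \<le> real CARD('d) / 2" "2 \<le> CARD('d)" using N_le d_ge by (auto simp: d_def)
  then have N_lt: "N < CARD('d)" using N_ge by linarith
  have lnd: "0 < ln (real d)" using d_ge by simp
  have Qr: "0 < real Q / \<rho>" "1 \<le> real Q / \<rho>" using Q_ge rho by (auto simp: field_simps)
  have lnQ: "0 \<le> ln (real Q / \<rho>)" using Qr by simp
  have Cln: "C * ln (real d) = 12 * ln (real d) + 4 * ln (real Q / \<rho>)"
    using lnd unfolding C_def by (simp add: log_def algebra_simps)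
  have d0: "0 < real d" using d_ge by simp
  have Cpos: "0 < C * ln (real d)" unfolding Cln using lnd lnQ by linarith
  then have \<kappa>0: "0 < \<kappa>" unfolding kappa_def using d0 by simp
  have \<kappa>2: "\<kappa>\<^sup>2 = C * ln (real d) / real d" unfolding kappa_def using Cpos d0 by simp
  note a = delta_powr_alpha[OF delta(1,2) alpha_def]
  have a0: "0 \<le> \<alpha>" using a(2) by simp
  have ad: "\<alpha> * \<delta> = 4 * sqrt (real N) * \<kappa> + 1 / sqrt (real N)"
  proof -
    have "\<alpha> * \<delta> = \<delta> / log 2 (1 / \<delta>)" by (simp add: alpha_def)
    also have "\<dots> = 4 * sqrt (real N * (C * ln (real d) / real d)) + 1 / sqrt (real N)"
      unfolding delta(3) by (simp add: mult_ac)
    finally show ?thesis unfolding kappa_def real_sqrt_mult[of "real N"] by simp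
  qed
  have kN: "ln (real N) * real N * \<kappa> \<le> 1 / 4" using N_cond by (simp add: kappa_def)
  note num = shield_parameters[OF N_ge \<kappa>0 kN delta(1,2) a(2,3) ad]
  note par = delta(1,2) \<kappa>0 num(3) a0 a(1)
  have sN: "0 < 1 / (4 * sqrt (real N))" using N_ge by simp
  have dk: "0 < \<delta> * \<kappa>" using delta \<kappa>0 by simp
  have numD: "real N * (2 * \<delta> * \<kappa>) + \<delta> * \<kappa> + 1 / (4 * sqrt (real N)) \<le> D"
    using num(1) unfolding D_def[symmetric] by (simp add: algebra_simps)
  have pos: "real N * (2 * \<delta> * \<kappa>) < D" using numD sN dk by linarith
  have pos': "real N * (2 * \<delta> * \<kappa>) < \<alpha> * \<delta> - (1 + \<alpha>) * sqrt (real N) * \<kappa>"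
    using pos by (simp add: D_def)
  have "0 \<le> real N * (2 * \<delta> * \<kappa>)" using delta \<kappa>0 by simp
  then have D0: "0 \<le> D" using pos by linarith

  interpret V: prob_space V by (rule haar_prob[OF haar])
  interpret R: prob_space R by (rule R_prob)
  interpret P: pair_prob_space V R ..
  let ?M = "V \<Otimes>\<^sub>M R"
  define H where "H k p = transcript cnt qry (f (fst p)) (sg (fst p)) (snd p) k" for k p
  define c where "c k p = cnt k (snd p) (H k p)" for k p
  define x where "x k q p = qry k (snd p) (H k p) q" for k q p
  have setsV: "sets (V \<Otimes>\<^sub>M borel) = sets (frame_space N \<Otimes>\<^sub>M (borel :: (real^'d) measure))"
    by (rule sets_pair_measure_cong[OF haar_sets[OF haar] refl])
  have fm: "(\<lambda>p. f (fst p) (snd p)) \<in> borel_measurable (V \<Otimes>\<^sub>M borel)"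
    unfolding f_def measurable_cong_sets[OF setsV refl]
    by (rule shielded_nemirovski_measurable[OF delta(1) a0])
  have gm: "(\<lambda>p. sg (fst p) (snd p)) \<in> borel_measurable (V \<Otimes>\<^sub>M borel)"
    using sg_meas by (simp add: split_beta)
  have cm [measurable]: "c k \<in> measurable ?M (count_space UNIV)" for k
    using transcript_measurable(2)[OF cnt_meas qry_meas fm gm, where k = k] by (simp add: c_def[abs_def] H_def)
  have xm [measurable]: "x k q \<in> borel_measurable ?M" for k q
    using transcript_measurable(3)[OF cnt_meas qry_meas fm gm, where k = k and q = q] by (simp add: x_def[abs_def] H_def)
  have vm [measurable]: "(\<lambda>p. fst p i) \<in> borel_measurable ?M" if "i \<in> {1..N}" for i
    by (rule measurable_compose[OF measurable_fst haar_component_measurable[OF haar that]])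
  have rm [measurable]: "(\<lambda>p. frame_resid k (fst p) (x k q p)) \<in> borel_measurable ?M" if "k \<le> N" for k q
    unfolding frame_resid_def
    by (intro borel_measurable_diff borel_measurable_sum borel_measurable_scaleR borel_measurable_inner xm vm)
      (use that in auto)
  have um: "Measurable.pred ?M (\<lambda>p. uncorrelated \<kappa> N k (fst p) (x k q p))" if "k < N" for k q
  proof -
    have [measurable]: "(\<lambda>p. frame_resid k (fst p) (x k q p)) \<in> borel_measurable ?M" using rm that by simp
    have "Measurable.pred ?M (\<lambda>p. \<bar>fst p i \<bullet> x k q p\<bar> < \<kappa> * norm (frame_resid k (fst p) (x k q p)))"
      if "i \<in> {k<..N}" for i
    proof -
      have [measurable]: "(\<lambda>p. fst p i) \<in> borel_measurable ?M" using vm that by simp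
      show ?thesis by measurable
    qed
    then have [measurable]: "Measurable.pred ?M (\<lambda>p. \<forall>i\<in>{k<..N}.
        \<bar>fst p i \<bullet> x k q p\<bar> < \<kappa> * norm (frame_resid k (fst p) (x k q p)))"
      by (rule pred_intros_countable_bounded)
    show ?thesis unfolding uncorrelated_def by measurable
  qed
  have om: "Measurable.pred ?M (\<lambda>p. orthonormal_frame N (fst p))"
    unfolding orthonormal_frame_def by measurable
  define good where "good k p \<longleftrightarrow> (\<forall>q<Q. q < c k p \<longrightarrow> uncorrelated \<kappa> N k (fst p) (x k q p))" for k p
  have goodm: "Measurable.pred ?M (good k)" if "k < N" for k
    unfolding good_def using um[OF that] by measurable
  have cQ: "c k p \<le> Q" for k p by (simp add: c_def cnt_le)
  \<comment> \<open>Round \<open>k\<close> is the first that can fail: all earlier rounds are good,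
    and query \<open>q\<close> is correlated with \<open>v i\<close>. Goodness of the earlier rounds
    is what makes this query a function of \<open>v 1\<close>, ..., \<open>v k\<close> on the
    event.\<close>
  define A where "A k q i = {p \<in> space ?M. orthonormal_frame N (fst p) \<and> (\<forall>j\<in>{..<k}. good j p) \<and>
      q < c k p \<and> frame_resid k (fst p) (x k q p) \<noteq> 0 \<and>
      \<kappa> * norm (frame_resid k (fst p) (x k q p)) \<le> \<bar>fst p i \<bullet> x k q p\<bar>}" for k q i
  have Am: "A k q i \<in> sets ?M" if "k < i" "i \<le> N" for k q i
  proof -
    have [measurable]: "(\<lambda>p. frame_resid k (fst p) (x k q p)) \<in> borel_measurable ?M" using rm that by simp
    have [measurable]: "(\<lambda>p. fst p i) \<in> borel_measurable ?M" using vm that by simp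
    have [measurable]: "Measurable.pred ?M (\<lambda>p. \<forall>j\<in>{..<k}. good j p)"
      using goodm that by (intro pred_intros_countable_bounded) auto
    note [measurable] = om
    show ?thesis unfolding A_def by measurable
  qed
  \<comment> \<open>As \<open>d - k \<ge> d / 2\<close>, the tail exponent
    \<open>\<kappa>^2 * (d - k) / 2\<close> is at least \<open>3 * ln d + ln (Q / \<rho>)\<close>,
    which is where the constants 12 and 4 in \<open>C\<close> enter.\<close>
  define pr where "pr = 2 * (\<rho> / (real d ^ 3 * real Q))"
  have pr0: "0 \<le> pr" using rho by (simp add: pr_def)
  have exp_le: "2 * exp (- \<kappa>\<^sup>2 * real (CARD('d) - k) / 2) \<le> pr" if "k < N" for k
  proof -
    have "real d / 2 \<le> real (CARD('d) - k)" using that dd N_lt by (simp add: d_def of_nat_diff)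
    then have "\<kappa>\<^sup>2 * (real d / 2) \<le> \<kappa>\<^sup>2 * real (CARD('d) - k)" by (intro mult_left_mono) auto
    moreover have "\<kappa>\<^sup>2 * (real d / 2) = 6 * ln (real d) + 2 * ln (real Q / \<rho>)"
      unfolding \<kappa>2 Cln using d0 by (simp add: field_simps)
    ultimately have "- \<kappa>\<^sup>2 * real (CARD('d) - k) / 2 \<le> - (3 * ln (real d) + ln (real Q / \<rho>))" by simp
    then have "exp (- \<kappa>\<^sup>2 * real (CARD('d) - k) / 2) \<le> exp (- (3 * ln (real d) + ln (real Q / \<rho>)))"
      by simp
    also have "3 * ln (real d) + ln (real Q / \<rho>) = ln (real d ^ 3 * (real Q / \<rho>))"
      using d0 Qr by (subst ln_mult_pos) (simp_all add: ln_realpow)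
    also have "exp (- ln (real d ^ 3 * (real Q / \<rho>))) = \<rho> / (real d ^ 3 * real Q)"
      using d0 Qr rho Q_ge by (simp add: exp_minus field_simps)
    finally show ?thesis by (simp add: pr_def)
  qed
  have Ap: "measure ?M (A k q i) \<le> pr" if "k < i" "i \<le> N" for k q i
  proof (rule P.measure_pair_le[OF Am[OF that] pr0])
    fix r assume r: "r \<in> space R"
    let ?S = "(\<lambda>v. (v, r)) -` A k q i"
    have S: "?S \<in> sets V" by (rule sets_Pair2[OF Am[OF that]])
    have "measure V ?S \<le> 2 * exp (- \<kappa>\<^sup>2 * real (CARD('d) - k) / 2)"
    proof (rule haar_frames_tail[OF haar _ _ that, where X = "\<lambda>v. x k q (v, r)"])
      show "?S \<in> sets (frame_space N)" using S haar_sets[OF haar] by simp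
      fix v v' assume v: "v \<in> ?S" and v': "v' \<in> ?S" and ag: "\<And>j. j \<in> {1..k} \<Longrightarrow> v j = v' j"
      have gd: "uncorrelated \<kappa> N j w (qry j r (transcript cnt qry (f w) (sg w) r j) q')"
        if "w \<in> ?S" "j < k" "q' < cnt j r (transcript cnt qry (f w) (sg w) r j)" for w j q'
      proof -
        have "good j (w, r)" using that(1,2) by (simp add: A_def)
        moreover have "q' < c j (w, r)" using that(3) by (simp add: c_def H_def)
        ultimately show ?thesis using cQ[of j "(w, r)"] by (auto simp: good_def x_def H_def)
      qed
      have "H k (v, r) = H k (v', r)"
        unfolding H_def fst_conv snd_conv f_eq
      proof (rule transcript_determined[OF _ _ _ N_lt par pos' ag qry_ball])
        show "orthonormal_frame N v" "orthonormal_frame N v'" using v v' by (auto simp: A_def)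
        show "k \<le> N" using that by simp
      qed (use sg_local gd[OF v] gd[OF v'] in \<open>unfold f_eq, blast+\<close>)
      then show "x k q (v, r) = x k q (v', r)" by (simp add: x_def)
    qed (use N_ge N_lt \<kappa>0 in \<open>auto simp: A_def\<close>)
    also have "\<dots> \<le> pr" using that by (intro exp_le) simp
    finally show "measure V ?S \<le> pr" .
  qed
  define I where "I = Sigma ({..<N} \<times> {..<Q}) (\<lambda>(k, q). {k<..N})"
  have finI: "finite I" unfolding I_def by (intro finite_SigmaI) auto
  have cardI: "card I \<le> N * Q * N"
  proof -
    have "I \<subseteq> ({..<N} \<times> {..<Q}) \<times> {1..N}" by (auto simp: I_def)
    then have "card I \<le> card (({..<N} \<times> {..<Q}) \<times> {1..N})" by (intro card_mono) auto
    then show ?thesis by (simp add: card_cartesian_product)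
  qed
  define AI where "AI = (\<lambda>((k, q), i). A k q i)"
  \<comment> \<open>Orthonormality holds only almost everywhere, so the exceptional frames are put
    into the bad set.\<close>
  define Z where "Z = {p \<in> space ?M. \<not> orthonormal_frame N (fst p)}"
  have Zm: "Z \<in> sets ?M" unfolding Z_def using om by measurable
  have Z0: "measure ?M Z \<le> 0"
  proof (rule P.measure_pair_le[OF Zm order_refl])
    fix r assume "r \<in> space R"
    have "AE v in V. v \<notin> (\<lambda>v. (v, r)) -` Z"
      using haar_ae[OF haar] by eventually_elim (simp add: Z_def)
    then show "measure V ((\<lambda>v. (v, r)) -` Z) \<le> 0"
      using V.prob_eq_0[OF sets_Pair2[OF Zm], of r] by simp
  qed
  have AIm: "AI a \<in> sets ?M" "measure ?M (AI a) \<le> pr" if "a \<in> I" for a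
    using that Am Ap by (auto simp: I_def AI_def)
  define B where "B = Z \<union> (\<Union>a\<in>I. AI a)"
  have UI: "(\<Union>a\<in>I. AI a) \<in> sets ?M" using AIm finI by (intro sets.finite_UN) auto
  have Bm: "B \<in> sets ?M" unfolding B_def using Zm UI by (intro sets.Un)
  have "measure ?M (\<Union>a\<in>I. AI a) \<le> (\<Sum>a\<in>I. measure ?M (AI a))"
    using AIm finI by (intro P.finite_measure_subadditive_finite) auto
  also have "\<dots> \<le> (\<Sum>a\<in>I. pr)" using AIm by (intro sum_mono)
  also have "\<dots> \<le> real (N * Q * N) * pr"
    unfolding sum_constant using cardI pr0 by (intro mult_right_mono of_nat_mono) simp_all
  also have "\<dots> \<le> \<rho>"
  proof -
    \<comment> \<open>At most \<open>N * Q * N\<close> events of probability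
      \<open>2 * \<rho> / (d ^ 3 * Q)\<close> each: \<open>N \<le> d / 2\<close> lets
      \<open>d ^ 3\<close> absorb \<open>2 * N ^ 2\<close>.\<close>
    have "real N * real N \<le> (real d / 2) * (real d / 2)" using N_le by (intro mult_mono) auto
    moreover have "0 \<le> real N * real N" by simp
    ultimately have "real N * real N * 2 \<le> real d ^ 2 * 1" unfolding power2_eq_square by linarith
    also have "\<dots> \<le> real d ^ 2 * real d" using d_ge by (intro mult_left_mono) auto
    finally have "real N * real N * 2 \<le> real d ^ 3" by (simp add: power3_eq_cube power2_eq_square)
    then have "real N * real N * 2 / real d ^ 3 \<le> 1" using d0 by simp
    then have "\<rho> * (real N * real N * 2 / real d ^ 3) \<le> \<rho> * 1" using rho by (intro mult_left_mono) auto
    moreover have "real (N * Q * N) * pr = \<rho> * (real N * real N * 2 / real d ^ 3)"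
      using Q_ge by (simp add: pr_def field_simps)
    ultimately show ?thesis by simp
  qed
  finally have "measure ?M (\<Union>a\<in>I. AI a) \<le> \<rho>" .
  moreover have "measure ?M B \<le> measure ?M Z + measure ?M (\<Union>a\<in>I. AI a)"
    unfolding B_def using Zm UI by (intro measure_Un_le)
  ultimately have Bp: "measure ?M B \<le> \<rho>" using Z0 by linarith

  have concl: "1 / (4 * sqrt (real N)) \<le> f (fst p) (x k q p) - (INF z\<in>cball 0 1. f (fst p) z)"
    if p: "p \<in> space ?M" "p \<notin> B" and k: "k < T" and q: "q < c k p" for p k q
  proof -
    have on: "orthonormal_frame N (fst p)" using p by (auto simp: B_def Z_def)
    have kN: "k < N" using k T_le by simp
    \<comment> \<open>Strong induction: with all earlier rounds good, a correlated query of round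
      \<open>j\<close> would put \<open>p\<close> into some \<open>A j q' i\<close> and hence into
      \<open>B\<close>.\<close>
    have gd: "good j p" if "j < N" for j
      using that
    proof (induction j rule: less_induct)
      case (less j)
      show ?case unfolding good_def
      proof (intro allI impI)
        fix q' assume q': "q' < Q" "q' < c j p"
        show "uncorrelated \<kappa> N j (fst p) (x j q' p)"
        proof (rule ccontr)
          assume "\<not> uncorrelated \<kappa> N j (fst p) (x j q' p)"
          then obtain i where i: "i \<in> {j<..N}" "frame_resid j (fst p) (x j q' p) \<noteq> 0"
            "\<kappa> * norm (frame_resid j (fst p) (x j q' p)) \<le> \<bar>fst p i \<bullet> x j q' p\<bar>"
            unfolding uncorrelated_def by (auto simp: not_less)
          then have "p \<in> A j q' i" using on p q' less by (auto simp: A_def)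
          moreover have "((j, q'), i) \<in> I" using i q' less by (auto simp: I_def)
          ultimately have "p \<in> B" unfolding B_def AI_def by force
          then show False using p by simp
        qed
      qed
    qed
    have "uncorrelated \<kappa> N k (fst p) (x k q p)"
      using gd[OF kN] q cQ[of k p] by (auto simp: good_def)
    from shielded_nemirovski_ge_uncorrelated[OF on kN par this]
    have low: "- \<kappa> * \<delta> - real N * (2 * \<delta> * \<kappa>) \<le> f (fst p) (x k q p)" unfolding f_eq .
    have "(INF z\<in>cball 0 1. f (fst p) z) \<le> max (- 1 / sqrt (real N) - 2 * \<delta> * \<kappa>) (- D)"
      unfolding f_eq D_def
      using N_ge D0 dk by (intro shielded_nemirovski_INF_le[OF on _ N_lt par(1-3,5,6)]) (auto simp: D_def)
    \<comment> \<open>Each of the two bounds on the minimum lies at least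
      \<open>1 / (4 * sqrt (real N))\<close> below the lower bound for queried values.\<close>
    moreover have "- 1 / sqrt (real N) - 2 * \<delta> * \<kappa> \<le> - \<kappa> * \<delta> - real N * (2 * \<delta> * \<kappa>) - 1 / (4 * sqrt (real N))"
      using num(2) N_ge by (simp add: algebra_simps)
    moreover have "- D \<le> - \<kappa> * \<delta> - real N * (2 * \<delta> * \<kappa>) - 1 / (4 * sqrt (real N))"
      using numD by (simp add: algebra_simps)
    ultimately show ?thesis using low by linarith
  qed
  show ?thesis
  proof (rule bexI[OF _ Bm], intro conjI Bp, clarify)
    fix v r k q
    assume vr: "(v, r) \<in> space ?M" "(v, r) \<notin> B" and k: "k < T"
      and q: "q < cnt k r (transcript cnt qry (f v) (sg v) r k)"
    then have "q < c k (v, r)" by (simp add: c_def H_def)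
    from concl[OF vr k this]
    show "f v (qry k r (transcript cnt qry (f v) (sg v) r k) q) - (INF z\<in>cball 0 1. f v z)
      \<ge> 1 / (4 * sqrt (real N))" by (simp add: x_def H_def)
  qed
qed

end
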